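(* Let $\bar x=\{x_1,\dots,x_n\}$ and $\bar u=\{u_1,\dots,u_n\}$ be sets of (generic) complex parameters, where $\bar x$ satisfies the Bethe equations $$\frac{\lambda_1(x_i)}{\lambda_2(x_i)}=\prod_{j\ne i}\frac{f(x_i,x_j)}{f(x_j,x_i)},\qquad i=1,\dots,n,$$ and $\bar u$ is free. Let $1\le m\le n$. Then the scalar product $S(\bar x|\bar u)=\mathbb{C}(\bar x)\mathbb{B}(\bar u)$ between on-shell and off-shell Bethe vectors is $$S(\bar x|\bar u)=\frac{1}{c^{n-m}}\mathop{\rm Sym}_{\bar u}\ \prod_{i=1}^{m}\Bigl\{J(u_i,x_i)\prod_{\ell=m+1}^{n}g(u_i,x_\ell)\Bigr\}\,\Delta'(\{u_1,\dots,u_m\})\,\Delta(\{x_1,\dots,x_m\})\ \prod_{\ell=m+1}^{n}g(u_\ell,x_\ell)\mathop{\rm res}_{z=u_\ell}\tau(z|\{u_1,\dots,u_\ell,x_{\ell+1},\dots,x_n\}).$$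
   Context: Let $c$ be a nonzero complex constant and put $g(u,v)=\frac{c}{u-v}$, $f(u,v)=\frac{u-v+c}{u-v}$, $h(u,v)=\frac{u-v+c}{c}$, $t(u,v)=\frac{g(u,v)}{h(u,v)}=\frac{c^2}{(u-v)(u-v+c)}$. Let $R(u,v)=\mathbf 1\otimes\mathbf 1+g(u,v)\mathbf P$ on $\mathbb{C}^2\otimes\mathbb{C}^2$, with $\mathbf P$ the permutation operator. The monodromy matrix $T(u)=(T_{ij}(u))_{i,j=1,2}$ has entries that are operators on a space $\mathcal H$ and satisfies $$R(u,v)\,T^{(1)}(u)\,T^{(2)}(v)=T^{(2)}(v)\,T^{(1)}(u)\,R(u,v),$$ where $T^{(i)}$ acts in the $i$-th tensor factor; consequently $[T_{ij}(u),T_{ij}(v)]=0$. There are a vacuum $|0\rangle\in\mathcal H$ and a dual vacuum $\langle 0|\in\mathcal H^*$ (with $\langle0|0\rangle=1$) such that $T_{ii}(u)|0\rangle=\lambda_i(u)|0\rangle$, $T_{21}(u)|0\rangle=0$, $\langle0|T_{ii}(u)=\lambda_i(u)\langle0|$, $\langle0|T_{12}(u)=0$. The complex-valued functions $\lambda_1,\lambda_2$ are free functional parameters (generalized model): no specific form is assumed. A function with a set as argument means the product over that set; e.g. $f(z,\bar w)=\prod_i f(z,w_i)$, $h(\bar x,u)=\prod_k h(x_k,u)$; empty products equal $1$. Bethe vectors: $\mathbb{B}(\bar u)=T_{12}(u_1)\cdots T_{12}(u_n)|0\rangle$. Dual Bethe vectors: $\mathbb{C}(\bar x)=\langle0|T_{21}(x_1)\cdots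 T_{21}(x_n)$. Transfer matrix eigenvalue function: $\tau(z|\bar w)=\lambda_1(z)f(\bar w,z)+\lambda_2(z)f(z,\bar w)$. For $u_\ell\in\bar w$ its residue (with the $\lambda_i$ regarded as regular at $u_\ell$) is $$\mathop{\rm res}_{z=u_\ell}\tau(z|\bar w)=c\bigl(\lambda_2(u_\ell)f(u_\ell,\bar w\setminus u_\ell)-\lambda_1(u_\ell)f(\bar w\setminus u_\ell,u_\ell)\bigr).$$ The function $J$ is $$J(u_j,x_k)=\frac{c}{g(u_j,\bar x)}\frac{\partial\tau(u_j|\bar x)}{\partial x_k}=\lambda_2(u_j)\,t(u_j,x_k)\,h(u_j,\bar x)+(-1)^{n-1}\lambda_1(u_j)\,t(x_k,u_j)\,h(\bar x,u_j),$$ where $\tau(u|\bar x)$ is differentiated as a function of independent variables $x_1,\dots,x_n$. $\Delta'(\{w_1,\dots,w_m\})=\prod_{1\le j<k\le m}g(w_j,w_k)$, $\Delta(\{w_1,\dots,w_m\})=\prod_{1\le k<j\le m}g(w_j,w_k)$. $\mathop{\rm Sym}_{\bar u}$ denotes the sum, without normalizing factor, over all $n!$ permutations of $u_1,\dots,u_n$ of the whole expression that follows.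
   Formalization: With the Bethe vectors unnormalized as in the context, the printed formula lacks the factor ∏λ_2(x_i) on the right (for n=m=1 the scalar product is λ_2(x)J(u,x)); the formal theorem includes this factor and gives the printed formula when ∏λ_2(x_i)=1. *)

theory Defs
  imports "HOL-Complex_Analysis.Complex_Analysis"
begin

definition gfun :: "complex \<Rightarrow> complex \<Rightarrow> complex \<Rightarrow> complex" where
  "gfun c u v = c / (u - v)"

definition ffun :: "complex \<Rightarrow> complex \<Rightarrow> complex \<Rightarrow> complex" where
  "ffun c u v = (u - v + c) / (u - v)"

definition hfun :: "complex \<Rightarrow> complex \<Rightarrow> complex \<Rightarrow> complex" where
  "hfun c u v = (u - v + c) / c"

definition tfun :: "complex \<Rightarrow> complex \<Rightarrow> complex \<Rightarrow> complex" where
  "tfun c u v = gfun c u v / hfun c u v"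

text \<open>
  A vector of \<open>C\<^sup>2 \<otimes> C\<^sup>2 \<otimes> H\<close> is given by its components \<open>\<psi> i k \<in> H\<close> with respect to
  the basis \<open>e\<^sub>i \<otimes> e\<^sub>k\<close> of \<open>C\<^sup>2 \<otimes> C\<^sup>2\<close>. The index type is the two-element type \<open>2\<close>,
  whose elements are \<open>1\<close> and \<open>2\<close>. The map \<open>scl\<close> is the scalar multiplication of \<open>H\<close>.
\<close>

definition perm_op :: "(2 \<Rightarrow> 2 \<Rightarrow> 'h) \<Rightarrow> 2 \<Rightarrow> 2 \<Rightarrow> 'h" where
  "perm_op \<psi> = (\<lambda>i k. \<psi> k i)"

definition R_op ::
  "(complex \<Rightarrow> 'h \<Rightarrow> 'h) \<Rightarrow> complex \<Rightarrow> complex \<Rightarrow> complex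
    \<Rightarrow> (2 \<Rightarrow> 2 \<Rightarrow> 'h::ab_group_add) \<Rightarrow> 2 \<Rightarrow> 2 \<Rightarrow> 'h" where
  "R_op scl c u v \<psi> = (\<lambda>i k. \<psi> i k + scl (gfun c u v) (perm_op \<psi> i k))"

definition T_first ::
  "(2 \<Rightarrow> 2 \<Rightarrow> complex \<Rightarrow> 'h \<Rightarrow> 'h) \<Rightarrow> complex
    \<Rightarrow> (2 \<Rightarrow> 2 \<Rightarrow> 'h::ab_group_add) \<Rightarrow> 2 \<Rightarrow> 2 \<Rightarrow> 'h" where
  "T_first T u \<psi> = (\<lambda>i k. \<Sum>j\<in>UNIV. T i j u (\<psi> j k))"

definition T_second ::
  "(2 \<Rightarrow> 2 \<Rightarrow> complex \<Rightarrow> 'h \<Rightarrow> 'h) \<Rightarrow> complex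
    \<Rightarrow> (2 \<Rightarrow> 2 \<Rightarrow> 'h::ab_group_add) \<Rightarrow> 2 \<Rightarrow> 2 \<Rightarrow> 'h" where
  "T_second T v \<psi> = (\<lambda>i k. \<Sum>l\<in>UNIV. T k l v (\<psi> i l))"

text \<open>
  The RTT relation is imposed for \<open>u \<noteq> v\<close> only, because \<open>R(u,v)\<close> has a pole at \<open>u = v\<close>.
\<close>

locale generalized_model = vector_space scl
  for scl :: "complex \<Rightarrow> 'h::ab_group_add \<Rightarrow> 'h" +
  fixes c :: complex
    and T :: "2 \<Rightarrow> 2 \<Rightarrow> complex \<Rightarrow> 'h \<Rightarrow> 'h"
    and lam :: "2 \<Rightarrow> complex \<Rightarrow> complex"
    and vac :: 'h
    and dvac :: "'h \<Rightarrow> complex"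
  assumes T_linear: "\<And>i j u. Vector_Spaces.linear scl scl (T i j u)"
    and dvac_linear: "Vector_Spaces.linear scl (*) dvac"
    and RTT: "\<And>u v. u \<noteq> v \<Longrightarrow>
      R_op scl c u v \<circ> T_first T u \<circ> T_second T v = T_second T v \<circ> T_first T u \<circ> R_op scl c u v"
    and dvac_vac: "dvac vac = 1"
    and T_diag_vac: "\<And>i u. T i i u vac = scl (lam i u) vac"
    and T21_vac: "\<And>u. T 2 1 u vac = 0"
    and dvac_T_diag: "\<And>i u \<psi>. dvac (T i i u \<psi>) = lam i u * dvac \<psi>"
    and dvac_T12: "\<And>u \<psi>. dvac (T 1 2 u \<psi>) = 0"

definition bethe_vector ::
  "(2 \<Rightarrow> 2 \<Rightarrow> complex \<Rightarrow> 'h \<Rightarrow> 'h) \<Rightarrow> 'h \<Rightarrow> nat \<Rightarrow> (nat \<Rightarrow> complex) \<Rightarrow> 'h" where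
  "bethe_vector T vac n u = foldr (\<lambda>i. T 1 2 (u i)) [1..<Suc n] vac"

definition dual_bethe_vector ::
  "(2 \<Rightarrow> 2 \<Rightarrow> complex \<Rightarrow> 'h \<Rightarrow> 'h) \<Rightarrow> ('h \<Rightarrow> complex) \<Rightarrow> nat \<Rightarrow> (nat \<Rightarrow> complex) \<Rightarrow> 'h \<Rightarrow> complex"
  where
  "dual_bethe_vector T dvac n x = (\<lambda>\<psi>. dvac (foldr (\<lambda>i. T 2 1 (x i)) [1..<Suc n] \<psi>))"

definition bethe_equations ::
  "complex \<Rightarrow> (2 \<Rightarrow> complex \<Rightarrow> complex) \<Rightarrow> nat \<Rightarrow> (nat \<Rightarrow> complex) \<Rightarrow> bool" where
  "bethe_equations c lam n x \<longleftrightarrow>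
     (\<forall>i\<in>{1..n}. lam 2 (x i) \<noteq> 0 \<and>
        lam 1 (x i) / lam 2 (x i) = (\<Prod>j\<in>{1..n}-{i}. ffun c (x i) (x j) / ffun c (x j) (x i)))"

text \<open>
  The set argument of \<open>\<tau>(z|w)\<close> is the family \<open>w\<close> indexed by the finite set \<open>I\<close>, so that
  its members are independent variables.
\<close>

definition tau ::
  "complex \<Rightarrow> (2 \<Rightarrow> complex \<Rightarrow> complex) \<Rightarrow> nat set \<Rightarrow> (nat \<Rightarrow> complex) \<Rightarrow> complex \<Rightarrow> complex" where
  "tau c lam I w z =
     lam 1 z * (\<Prod>i\<in>I. ffun c (w i) z) + lam 2 z * (\<Prod>i\<in>I. ffun c z (w i))"

text \<open>
  The residue of \<open>\<tau>(z|w)\<close> at \<open>z = w l\<close>. It is given by its explicit value, because the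
  functions \<open>lam i\<close> are arbitrary; see \<open>tau_res_eq_residue\<close> for the case of regular ones.
\<close>

definition tau_res ::
  "complex \<Rightarrow> (2 \<Rightarrow> complex \<Rightarrow> complex) \<Rightarrow> nat set \<Rightarrow> (nat \<Rightarrow> complex) \<Rightarrow> nat \<Rightarrow> complex" where
  "tau_res c lam I w l =
     c * (lam 2 (w l) * (\<Prod>i\<in>I-{l}. ffun c (w l) (w i))
        - lam 1 (w l) * (\<Prod>i\<in>I-{l}. ffun c (w i) (w l)))"

text \<open>\<open>J_fun c lam n x k v\<close> is \<open>J(v, x k)\<close>; the closed form is \<open>J_fun_explicit\<close>.\<close>

definition J_fun ::
  "complex \<Rightarrow> (2 \<Rightarrow> complex \<Rightarrow> complex) \<Rightarrow> nat \<Rightarrow> (nat \<Rightarrow> complex) \<Rightarrow> nat \<Rightarrow> complex \<Rightarrow> complex" where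
  "J_fun c lam n x k v =
     c / (\<Prod>i=1..n. gfun c v (x i)) * deriv (\<lambda>y. tau c lam {1..n} (x(k := y)) v) (x k)"

definition Delta_prime :: "complex \<Rightarrow> nat \<Rightarrow> (nat \<Rightarrow> complex) \<Rightarrow> complex" where
  "Delta_prime c m w = (\<Prod>j=1..m. \<Prod>k\<in>{j<..m}. gfun c (w j) (w k))"

definition Delta :: "complex \<Rightarrow> nat \<Rightarrow> (nat \<Rightarrow> complex) \<Rightarrow> complex" where
  "Delta c m w = (\<Prod>k=1..m. \<Prod>j\<in>{k<..m}. gfun c (w j) (w k))"

definition Sym :: "nat \<Rightarrow> (nat \<Rightarrow> complex) \<Rightarrow> ((nat \<Rightarrow> complex) \<Rightarrow> complex) \<Rightarrow> complex" where
  "Sym n u F = (\<Sum>\<sigma> | \<sigma> permutes {1..n}. F (u \<circ> \<sigma>))"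

lemma J_fun_explicit:
  assumes c: "c \<noteq> 0" and k: "k \<in> {1..n}"
    and ne: "\<And>i. i \<in> {1..n} \<Longrightarrow> v \<noteq> x i"
    and h1: "v - x k + c \<noteq> 0" and h2: "x k - v + c \<noteq> 0"
  shows "J_fun c lam n x k v =
     lam 2 v * tfun c v (x k) * (\<Prod>i=1..n. hfun c v (x i))
     + (-1) ^ (n - 1) * lam 1 v * tfun c (x k) v * (\<Prod>i=1..n. hfun c (x i) v)"
proof -
  let ?A = "{1..n} - {k}"
  have vk: "v \<noteq> x k" using ne k by blast
  have split: "(\<Prod>i=1..n. F i) = F k * (\<Prod>i\<in>?A. F i)" for F :: "nat \<Rightarrow> complex"
    using k by (simp add: prod.remove)
  define P1 where "P1 = (\<Prod>i\<in>?A. ffun c (x i) v)"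
  define P2 where "P2 = (\<Prod>i\<in>?A. ffun c v (x i))"
  have tau_eq: "tau c lam {1..n} (x(k := y)) v
      = lam 1 v * (ffun c y v * P1) + lam 2 v * (ffun c v y * P2)" for y
    unfolding tau_def split P1_def P2_def by simp
  have d1: "((\<lambda>y. ffun c y v) has_field_derivative (- c / (x k - v)^2)) (at (x k))"
    unfolding ffun_def using vk
    by (auto intro!: derivative_eq_intros simp: divide_simps power2_eq_square algebra_simps)
  have d2: "((\<lambda>y. ffun c v y) has_field_derivative (c / (v - x k)^2)) (at (x k))"
    unfolding ffun_def using vk
    by (auto intro!: derivative_eq_intros simp: divide_simps power2_eq_square algebra_simps)
  have "((\<lambda>y. tau c lam {1..n} (x(k := y)) v) has_field_derivative
      lam 1 v * ((- c / (x k - v)^2) * P1) + lam 2 v * ((c / (v - x k)^2) * P2)) (at (x k))"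
    unfolding tau_eq by (intro DERIV_add DERIV_cmult DERIV_cmult_right d1 d2)
  hence D: "deriv (\<lambda>y. tau c lam {1..n} (x(k := y)) v) (x k)
      = lam 1 v * ((- c / (x k - v)^2) * P1) + lam 2 v * ((c / (v - x k)^2) * P2)"
    by (rule DERIV_imp_deriv)
  define G where "G = (\<Prod>i\<in>?A. gfun c v (x i))"
  have G0: "G \<noteq> 0" unfolding G_def gfun_def using c ne by auto
  define H1 where "H1 = (\<Prod>i\<in>?A. hfun c (x i) v)"
  define H2 where "H2 = (\<Prod>i\<in>?A. hfun c v (x i))"
  have P2: "P2 = G * H2"
    unfolding P2_def G_def H2_def prod.distrib[symmetric]
    by (rule prod.cong) (use c in \<open>auto simp: ffun_def gfun_def hfun_def\<close>)
  have "P1 = (\<Prod>i\<in>?A. - 1 * (gfun c v (x i) * hfun c (x i) v))"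
    unfolding P1_def
  proof (rule prod.cong)
    fix i assume "i \<in> ?A"
    hence "v - x i \<noteq> 0" "x i - v \<noteq> 0" using ne[of i] by auto
    thus "ffun c (x i) v = - 1 * (gfun c v (x i) * hfun c (x i) v)"
      using c unfolding ffun_def gfun_def hfun_def by (simp add: divide_simps) (simp add: algebra_simps)
  qed simp
  also have "\<dots> = (-1) ^ (n - 1) * (G * H1)"
    unfolding prod.distrib G_def H1_def using k by (simp add: card_Diff_singleton)
  finally have P1: "P1 = (-1) ^ (n - 1) * (G * H1)" .
  have a: "c / gfun c v (x k) * (c / (v - x k)^2) = tfun c v (x k) * hfun c v (x k)"
    using c vk h1 unfolding tfun_def gfun_def hfun_def
    by (simp add: divide_simps power2_eq_square)
  have xv: "x k - v \<noteq> 0" "v - x k \<noteq> 0" using vk by auto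
  have b: "c / gfun c v (x k) * (- c / (x k - v)^2) = tfun c (x k) v * hfun c (x k) v"
    using c xv h2 unfolding tfun_def gfun_def hfun_def
    by (simp add: divide_simps power2_eq_square) (simp add: algebra_simps)
  have alg: "c / (a * G) * (L1 * (A * (e * (G * B1))) + L2 * (B * (G * B2)))
      = L1 * (c / a * A) * (e * B1) + L2 * (c / a * B) * B2" for a A B L1 L2 e B1 B2
    using G0 by (cases "a = 0") (simp_all add: divide_simps, simp add: algebra_simps)
  have "J_fun c lam n x k v = c / (gfun c v (x k) * G) *
      (lam 1 v * ((- c / (x k - v)^2) * ((-1) ^ (n - 1) * (G * H1)))
       + lam 2 v * ((c / (v - x k)^2) * (G * H2)))"
    unfolding J_fun_def D split P1 P2 G_def[symmetric] ..
  also have "\<dots> = lam 1 v * (c / gfun c v (x k) * (- c / (x k - v)^2)) * ((-1) ^ (n - 1) * H1)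
       + lam 2 v * (c / gfun c v (x k) * (c / (v - x k)^2)) * H2"
    by (rule alg)
  also have "\<dots> = lam 2 v * tfun c v (x k) * (hfun c v (x k) * H2)
     + (-1) ^ (n - 1) * lam 1 v * tfun c (x k) v * (hfun c (x k) v * H1)"
    unfolding a b by (simp add: algebra_simps)
  finally show ?thesis unfolding split H1_def H2_def .
qed

lemma tau_res_eq_residue:
  assumes fin: "finite I" and l: "l \<in> I" and inj: "inj_on w I"
    and hol: "\<And>i. lam i analytic_on {w l}"
  shows "residue (tau c lam I w) (w l) = tau_res c lam I w l"
proof -
  let ?A = "I - {l}"
  have ne: "w i \<noteq> w l" if "i \<in> ?A" for i
    using that inj l by (auto dest: inj_onD)
  have ne': "w l \<noteq> w i" if "i \<in> ?A" for i
    using ne[OF that] by simp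
  define Q where "Q = (\<lambda>z. lam 1 z * ((w l - z + c) * (-1)) * (\<Prod>i\<in>?A. ffun c (w i) z)
      + lam 2 z * (z - w l + c) * (\<Prod>i\<in>?A. ffun c z (w i)))"
  have "Q analytic_on {w l}"
    unfolding Q_def ffun_def
    by (intro analytic_intros hol) (use ne ne' in auto)
  then obtain S where S: "open S" "w l \<in> S" "Q holomorphic_on S"
    by (auto simp: analytic_at)
  have eq: "tau c lam I w z = Q z / (z - w l)" for z
  proof -
    have r: "prod F I = F l * prod F ?A" for F :: "nat \<Rightarrow> complex"
      using fin l by (rule prod.remove)
    have e1: "ffun c (w l) z = ((w l - z + c) * (-1)) / (z - w l)"
      unfolding ffun_def by (metis minus_diff_eq minus_divide_divide mult.commute mult_minus1)
    have e2: "ffun c z (w l) = (z - w l + c) / (z - w l)"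
      by (rule ffun_def)
    have alg: "a * (p / d * P) + b * (q / d * P') = (a * p * P + b * q * P') / d"
      for a b p q d P P' :: complex
      by (simp add: add_divide_distrib mult.assoc)
    show ?thesis unfolding tau_def Q_def r e1 e2 by (rule alg)
  qed
  have "residue (\<lambda>z. Q z / (z - w l)) (w l) = Q (w l)"
    by (rule residue_simple[OF S])
  moreover have "Q (w l) = tau_res c lam I w l"
    unfolding Q_def tau_res_def by (simp add: algebra_simps)
  moreover have "tau c lam I w = (\<lambda>z. Q z / (z - w l))" using eq by blast
  ultimately show ?thesis by simp
qed

end

theory Submission
  imports Defs "HOL-Library.Function_Algebras"
    "HOL-Computational_Algebra.Fundamental_Theorem_Algebra"
begin

text \<open>
  Since the dual Bethe vector at on-shell \<open>X = {x\<^sub>1,\<dots>,x\<^sub>n}\<close> is an eigenvector of the transfer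
  matrix, \<open>S(X|V)\<close>, as a function of \<open>V\<close>, satisfies linear exchange relations between the
  \<open>n\<close>-element subsets of any \<open>n + 1\<close> points. A partial fraction identity shows that the Slavnov
  determinant satisfies the same relations.

  The scalar product depends on the functions \<open>\<lambda>\<^sub>1, \<lambda>\<^sub>2\<close> only through their values at \<open>X\<close> and
  \<open>V\<close>, and a chain of Verma modules realizes arbitrary values at finitely many points. Hence one may
  assume \<open>\<lambda>\<^sub>1(x + c) = 1\<close> and \<open>\<lambda>\<^sub>2(x + c) = 0\<close> for \<open>x \<in> X\<close>. The eigenvalue \<open>\<tau>(x + c|X)\<close> then
  vanishes, and the exchange relations at the points \<open>x + c\<close> become Cauchy systems, which
  determine every \<open>S(X|V)\<close> from \<open>S(X|X + c)\<close>; the latter is a product of quantum determinants.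
  This proves the formula for \<open>m = n\<close>.

  For \<open>m < n\<close>, peeling off \<open>u\<^sub>n,\<dots>,u\<^bsub>m+1\<^esub>\<close> in the symmetrization expresses the right-hand side
  by that for \<open>m\<close> points and dressed \<open>\<lambda>\<^sub>1, \<lambda>\<^sub>2\<close>. By the same partial fraction identity, passing
  from \<open>m\<close> to \<open>m - 1\<close> replaces one column of the determinant by a linear combination of its columns,
  so the right-hand side does not depend on \<open>m\<close>.
\<close>

section \<open>Exchange relations\<close>

text \<open>Together with \<open>gfun_neg\<close> this lets the relations of \<open>T 2 2\<close> be
  read as those of \<open>T 1 1\<close> with \<open>- c\<close> in place of
  \<open>c\<close>.\<close>

lemma ffun_neg: "ffun (- c) u v = ffun c v u"
  unfolding ffun_def by (metis minus_diff_eq minus_divide_divide minus_add_distrib add.inverse_inverse)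

lemma gfun_neg: "gfun (- c) u v = gfun c v u"
  unfolding gfun_def by (metis minus_diff_eq minus_divide_divide add.inverse_inverse)

lemma gfun_swap: "gfun c u v = - gfun c v u"
  unfolding gfun_def by (metis minus_diff_eq minus_divide_right)

lemma ffun_gfun: "u \<noteq> v \<Longrightarrow> ffun c u v = 1 + gfun c u v"
  unfolding ffun_def gfun_def by (simp add: field_simps)

text \<open>Merges the two contributions to the same unwanted vector in the induction for
  \<open>A_fold\<close>.\<close>

lemma ffun_gfun_three_term:
  assumes "z \<noteq> u" "z \<noteq> w" "u \<noteq> w"
  shows "ffun c u z * gfun c z w + gfun c z u * gfun c u w = gfun c z w * ffun c u w"
  using assms unfolding ffun_def gfun_def
  by (simp add: divide_simps) (simp add: algebra_simps)

text \<open>One setting for the actions of \<open>T 1 1\<close> and \<open>T 2 2\<close> on Bethe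
  vectors and on their duals. The relation \<open>A_B\<close> is assumed only on products of the
  \<open>B u\<close> applied to \<open>v0\<close>: in the dual instances the space consists of all
  complex-valued functions, and the relation is available for the linear ones among them.\<close>

locale exchange = vector_space scl
  for scl :: "complex \<Rightarrow> 'v::ab_group_add \<Rightarrow> 'v" +
  fixes c :: complex and A B :: "complex \<Rightarrow> 'v \<Rightarrow> 'v" and v0 :: 'v and l :: "complex \<Rightarrow> complex"
  assumes B_add: "B u (a + b) = B u a + B u b"
    and B_scale: "B u (scl r a) = scl r (B u a)"
    and B_commute: "B u (B v a) = B v (B u a)"
    and A_v0: "A z v0 = scl (l z) v0"
    and A_B: "finite W \<Longrightarrow> z \<noteq> u \<Longrightarrow>
      A z (B u (Finite_Set.fold B v0 W)) =
        scl (ffun c u z) (B u (A z (Finite_Set.fold B v0 W))) +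
        scl (gfun c z u) (B z (A u (Finite_Set.fold B v0 W)))"
begin

sublocale B: comp_fun_commute B
  by standard (simp add: fun_eq_iff B_commute)

lemma B_sum: "B u (sum F W) = (\<Sum>w\<in>W. B u (F w))"
proof -
  have "B u 0 = 0" using B_scale[of u 0 0] by simp
  then show ?thesis by (induct W rule: infinite_finite_induct) (simp_all add: B_add)
qed

text \<open>Induction on \<open>W\<close>. After \<open>A z\<close> is moved past a new
  \<open>B u\<close>, the vector in which \<open>z\<close> replaces some \<open>w\<close> in
  \<open>W\<close> arises twice, once from \<open>A z\<close> and once from \<open>A u\<close>, and
  the three-term identity adds the two coefficients. The vector in which \<open>z\<close> replaces
  \<open>u\<close> arises only once.\<close>

theorem A_fold:
  assumes "finite W" "z \<notin> W"
  shows "A z (Finite_Set.fold B v0 W) =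
    scl (l z * (\<Prod>w\<in>W. ffun c w z)) (Finite_Set.fold B v0 W) +
    (\<Sum>w\<in>W. scl (gfun c z w * l w * (\<Prod>y\<in>W-{w}. ffun c y w))
      (Finite_Set.fold B v0 (insert z (W - {w}))))"
  using assms
proof (induction W arbitrary: z)
  case empty
  then show ?case by (simp add: A_v0)
next
  case (insert u W)
  let ?B = "Finite_Set.fold B v0"
  have zu: "z \<noteq> u" and zW: "z \<notin> W" using insert.prems by auto
  have fz: "(\<Sum>w\<in>W. scl a (B u (scl (G w) (?B (insert z (W - {w})))))) =
     (\<Sum>w\<in>W. scl (a * G w) (?B (insert z (insert u W - {w}))))" for a G
  proof (rule sum.cong)
    fix w assume w: "w \<in> W"
    have "u \<notin> insert z (W - {w})" using zu insert.hyps by auto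
    hence "B u (?B (insert z (W - {w}))) = ?B (insert u (insert z (W - {w})))"
      using insert.hyps by simp
    also have "insert u (insert z (W - {w})) = insert z (insert u W - {w})"
      using w insert.hyps by auto
    finally show "scl a (B u (scl (G w) (?B (insert z (W - {w}))))) =
      scl (a * G w) (?B (insert z (insert u W - {w})))"
      by (simp add: B_scale)
  qed simp
  have fu: "(\<Sum>w\<in>W. scl a (B z (scl (G w) (?B (insert u (W - {w})))))) =
     (\<Sum>w\<in>W. scl (a * G w) (?B (insert z (insert u W - {w}))))" for a G
  proof (rule sum.cong)
    fix w assume w: "w \<in> W"
    have "z \<notin> insert u (W - {w})" using zu zW by auto
    hence "B z (?B (insert u (W - {w}))) = ?B (insert z (insert u (W - {w})))"
      using insert.hyps by simp
    also have "insert z (insert u (W - {w})) = insert z (insert u W - {w})"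
      using w insert.hyps by auto
    finally show "scl a (B z (scl (G w) (?B (insert u (W - {w}))))) =
      scl (a * G w) (?B (insert z (insert u W - {w})))"
      by (simp add: B_scale)
  qed simp
  have dist: "scl a (B y (scl r X + (\<Sum>w\<in>W. Y w)))
      = scl (a * r) (B y X) + (\<Sum>w\<in>W. scl a (B y (Y w)))" for a y r X Y
    by (simp add: B_add B_sum B_scale scale_right_distrib scale_sum_right)
  have tt: "ffun c u z * (gfun c z w * l w * P) + gfun c z u * (gfun c u w * l w * P)
      = gfun c z w * l w * (ffun c u w * P)" if "w \<in> W" for w P
  proof -
    have "z \<noteq> w" "u \<noteq> w" using that zW insert.hyps by auto
    from ffun_gfun_three_term[OF zu this, of c]
    have "(ffun c u z * gfun c z w + gfun c z u * gfun c u w) * (l w * P)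
      = (gfun c z w * ffun c u w) * (l w * P)" by simp
    thus ?thesis by (simp add: algebra_simps)
  qed
  have P: "(\<Prod>y\<in>insert u W-{w}. ffun c y w) = ffun c u w * (\<Prod>y\<in>W-{w}. ffun c y w)" if "w \<in> W" for w
  proof -
    have "insert u W - {w} = insert u (W - {w})" using that insert.hyps by auto
    thus ?thesis using insert.hyps by simp
  qed
  have Pu: "insert u W - {u} = W" using insert.hyps by auto
  have Bz: "B z (?B W) = ?B (insert z W)" using zW insert.hyps by simp
  have Bu: "B u (?B W) = ?B (insert u W)" using insert.hyps by simp
  have "A z (?B (insert u W)) = scl (ffun c u z) (B u (A z (?B W))) + scl (gfun c z u) (B z (A u (?B W)))"
    using A_B[OF insert.hyps(1) zu] insert.hyps by simp
  also have "\<dots> = (scl (ffun c u z * (l z * (\<Prod>w\<in>W. ffun c w z))) (?B (insert u W)) +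
      (\<Sum>w\<in>W. scl (ffun c u z * (gfun c z w * l w * (\<Prod>y\<in>W-{w}. ffun c y w)))
        (?B (insert z (insert u W - {w}))))) +
     (scl (gfun c z u * (l u * (\<Prod>w\<in>W. ffun c w u))) (?B (insert z W)) +
      (\<Sum>w\<in>W. scl (gfun c z u * (gfun c u w * l w * (\<Prod>y\<in>W-{w}. ffun c y w)))
        (?B (insert z (insert u W - {w})))))"
    unfolding insert.IH[OF zW] insert.IH[OF insert.hyps(2)] dist fz fu Bz Bu ..
  also have "\<dots> = scl (l z * (ffun c u z * (\<Prod>w\<in>W. ffun c w z))) (?B (insert u W)) +
     (scl (gfun c z u * l u * (\<Prod>w\<in>W. ffun c w u)) (?B (insert z W)) +
      ((\<Sum>w\<in>W. scl (ffun c u z * (gfun c z w * l w * (\<Prod>y\<in>W-{w}. ffun c y w)))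
        (?B (insert z (insert u W - {w})))) +
       (\<Sum>w\<in>W. scl (gfun c z u * (gfun c u w * l w * (\<Prod>y\<in>W-{w}. ffun c y w)))
        (?B (insert z (insert u W - {w}))))))"
    by (simp add: algebra_simps)
  also have "((\<Sum>w\<in>W. scl (ffun c u z * (gfun c z w * l w * (\<Prod>y\<in>W-{w}. ffun c y w)))
        (?B (insert z (insert u W - {w})))) +
       (\<Sum>w\<in>W. scl (gfun c z u * (gfun c u w * l w * (\<Prod>y\<in>W-{w}. ffun c y w)))
        (?B (insert z (insert u W - {w}))))) =
     (\<Sum>w\<in>W. scl (gfun c z w * l w * (\<Prod>y\<in>insert u W-{w}. ffun c y w))
        (?B (insert z (insert u W - {w}))))"
    unfolding sum.distrib[symmetric] scale_left_distrib[symmetric]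
    by (rule sum.cong) (simp_all only: tt P)
  finally show ?case
    using insert.hyps by (simp add: Pu)
qed

end

section \<open>Commutation relations of the monodromy entries\<close>

context generalized_model
begin

lemma T_add: "T i j u (a + b) = T i j u a + T i j u b"
  and T_scale: "T i j u (scl r a) = scl r (T i j u a)"
  using T_linear[of i j u] unfolding module_hom_iff_linear[symmetric]
  by (simp_all add: module_hom.add module_hom.scale)

lemma T_zero: "T i j u 0 = 0"
  using T_scale[of i j u 0 0] by simp

lemma dvac_add: "dvac (a + b) = dvac a + dvac b"
  and dvac_scale: "dvac (scl r a) = r * dvac a"
  using dvac_linear unfolding module_hom_iff_linear[symmetric]
  by (simp_all add: module_hom.add module_hom.scale)

lemma RTT_component:
  assumes "u \<noteq> v"
  shows "T i j u (T k l v a) + scl (gfun c u v) (T k j u (T i l v a)) =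
     T k l v (T i j u a) + scl (gfun c u v) (T k j v (T i l u a))"
proof -
  \<comment> \<open>The vector with the single component \<open>a\<close> at position (j, l) picks
    out one matrix element of the RTT relation.\<close>
  let ?\<psi> = "\<lambda>p q. if p = j \<and> q = l then a else 0"
  have s: "(\<Sum>q\<in>UNIV. T p q w (if q = r then b else 0)) = T p r w b" for p r w b
    by (simp add: if_distrib[of "T p _ w"] T_zero cong: if_cong)
  have tf: "T_first T w (\<lambda>p q. if p = r \<and> q = s then b else 0)
      = (\<lambda>p q. if q = s then T p r w b else 0)" for w r s b
    by (intro ext) (simp add: T_first_def s T_zero)
  have ts: "T_second T w (\<lambda>p q. if p = r \<and> q = s then b else 0)
      = (\<lambda>p q. if p = r then T q s w b else 0)" for w r s b
    by (intro ext) (simp add: T_second_def s T_zero)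
  have L: "T_first T u (T_second T v ?\<psi>) p q = T p j u (T q l v a)" for p q
    unfolding ts by (simp add: T_first_def s)
  have m: "T_second T v (T_first T u (\<lambda>p q. if p = r \<and> q = t then b else 0)) p q = T q t v (T p r u b)"
    for p q r t b
    unfolding tf by (simp add: T_second_def s)
  have R: "T_second T v (T_first T u (R_op scl c u v ?\<psi>)) p q =
      T q l v (T p j u a) + scl (gfun c u v) (T q j v (T p l u a))" for p q
  proof -
    have e: "R_op scl c u v ?\<psi> = (\<lambda>p q. (\<lambda>p q. if p = j \<and> q = l then a else 0) p q
        + (\<lambda>p q. if p = l \<and> q = j then scl (gfun c u v) a else 0) p q)"
      by (intro ext) (auto simp: R_op_def perm_op_def)
    have add: "T_second T v (T_first T u (\<lambda>p q. F p q + G p q)) p q =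
       T_second T v (T_first T u F) p q + T_second T v (T_first T u G) p q" for F G
      by (simp add: T_second_def T_first_def T_add sum.distrib)
    show ?thesis unfolding e add m by (simp add: T_scale)
  qed
  have "(R_op scl c u v \<circ> T_first T u \<circ> T_second T v) ?\<psi> i k =
      (T_second T v \<circ> T_first T u \<circ> R_op scl c u v) ?\<psi> i k"
    by (simp add: RTT[OF assms])
  thus ?thesis by (simp add: R_op_def perm_op_def L R[unfolded R_op_def perm_op_def])
qed

lemma T_same_row_column_commute:
  assumes "c \<noteq> 0"
  shows "T i j u (T i j v a) = T i j v (T i j u a)"
proof (cases "u = v")
  case False
  have *: "scl (1 + gfun c p q) (T i j p (T i j q a)) = scl (1 + gfun c p q) (T i j q (T i j p a))"
    if "p \<noteq> q" for p q
    using RTT_component[OF that, of i j i j a] by (simp add: scale_left_distrib)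
  \<comment> \<open>By antisymmetry of \<open>gfun\<close>, if one of the two factors vanishes, then
    the other equals 2.\<close>
  have "1 + gfun c u v \<noteq> 0 \<or> 1 + gfun c v u \<noteq> 0"
    using gfun_swap[of c u v] by (auto simp: add_eq_0_iff2)
  thus ?thesis using *[OF False] *[OF False[symmetric]] by (metis scale_left_imp_eq)
qed simp

lemma T11_T12:
  assumes "z \<noteq> u"
  shows "T 1 1 z (T 1 2 u a) =
    scl (ffun c u z) (T 1 2 u (T 1 1 z a)) + scl (gfun c z u) (T 1 2 z (T 1 1 u a))"
  using RTT_component[OF assms[symmetric], of 1 2 1 1 a] assms
  by (simp add: ffun_gfun scale_left_distrib gfun_swap[of c z u] algebra_simps)

lemma T22_T12:
  assumes "z \<noteq> u"
  shows "T 2 2 z (T 1 2 u a) =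
    scl (ffun c z u) (T 1 2 u (T 2 2 z a)) + scl (gfun c u z) (T 1 2 z (T 2 2 u a))"
  using RTT_component[OF assms, of 2 2 1 2 a] assms
  by (simp add: ffun_gfun scale_left_distrib gfun_swap[of c u z] algebra_simps)

lemma T21_T11:
  assumes "z \<noteq> x"
  shows "T 2 1 x (T 1 1 z a) =
    scl (ffun c x z) (T 1 1 z (T 2 1 x a)) + scl (gfun c z x) (T 1 1 x (T 2 1 z a))"
  using RTT_component[OF assms[symmetric], of 2 1 1 1 a] assms
  by (simp add: ffun_gfun scale_left_distrib gfun_swap[of c z x] algebra_simps)

lemma T21_T22:
  assumes "z \<noteq> x"
  shows "T 2 1 x (T 2 2 z a) =
    scl (ffun c z x) (T 2 2 z (T 2 1 x a)) + scl (gfun c x z) (T 2 2 x (T 2 1 z a))"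
  using RTT_component[OF assms, of 2 2 2 1 a] assms
  by (simp add: ffun_gfun scale_left_distrib gfun_swap[of c x z] algebra_simps)

lemma T21_T12:
  assumes "x \<noteq> u"
  shows "T 2 1 x (T 1 2 u a) = T 1 2 u (T 2 1 x a) + scl (gfun c x u) (T 1 1 u (T 2 2 x a))
    - scl (gfun c x u) (T 1 1 x (T 2 2 u a))"
  using RTT_component[OF assms, of 2 1 1 2 a] by (simp add: algebra_simps)

end

section \<open>Bethe vectors\<close>

definition transfer_value ::
  "complex \<Rightarrow> (2 \<Rightarrow> complex \<Rightarrow> complex) \<Rightarrow> complex set \<Rightarrow> complex \<Rightarrow> complex" where
  "transfer_value c lam V z = lam 1 z * (\<Prod>v\<in>V. ffun c v z) + lam 2 z * (\<Prod>v\<in>V. ffun c z v)"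

text \<open>Up to the factor \<open>- c\<close>, the residue of \<open>transfer_value\<close> at the
  member \<open>v\<close> of \<open>V\<close>, the functions \<open>lam i\<close> being taken as
  regular there. Its vanishing is the Bethe equation of \<open>v\<close>, written without a quotient
  of vacuum eigenvalues.\<close>

definition bethe_defect ::
  "complex \<Rightarrow> (2 \<Rightarrow> complex \<Rightarrow> complex) \<Rightarrow> complex set \<Rightarrow> complex \<Rightarrow> complex" where
  "bethe_defect c lam V v =
     lam 1 v * (\<Prod>y\<in>V-{v}. ffun c y v) - lam 2 v * (\<Prod>y\<in>V-{v}. ffun c v y)"

lemma sum_fun_eval: "(\<Sum>i\<in>I. F i) a = (\<Sum>i\<in>I. F i a)"
  by (induct I rule: infinite_finite_induct) simp_all

lemma foldr_eq_fold:
  assumes "comp_fun_commute f" "distinct is" "inj_on w (set is)"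
  shows "foldr (\<lambda>i. f (w i)) is a = Finite_Set.fold f a (w ` set is)"
proof -
  interpret comp_fun_commute f by fact
  show ?thesis using assms(2,3) by (induct "is") auto
qed

lemma fold_insert_commute:
  assumes "comp_fun_commute f" "finite A" "x \<notin> A"
  shows "Finite_Set.fold f a (insert x A) = f x (Finite_Set.fold f a A)"
    and "Finite_Set.fold f a (insert x A) = Finite_Set.fold f (f x a) A"
proof -
  interpret comp_fun_commute f by fact
  show "Finite_Set.fold f a (insert x A) = f x (Finite_Set.fold f a A)"
    "Finite_Set.fold f a (insert x A) = Finite_Set.fold f (f x a) A"
    using assms(2,3) by (simp_all add: fold_fun_left_comm)
qed

locale generalized_model_nondeg = generalized_model +
  assumes c_nonzero: "c \<noteq> 0"
begin

lemma comp_fun_commute_T: "comp_fun_commute (T i j)"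
  by standard (simp add: fun_eq_iff T_same_row_column_commute[OF c_nonzero])

text \<open>The factors commute, so the vector depends only on the set of its parameters. With a
  fold over this set, replacing one parameter by another becomes an operation on sets.\<close>

definition bethe :: "complex set \<Rightarrow> 'a" where
  "bethe W = Finite_Set.fold (T 1 2) vac W"

text \<open>A fold on functionals rather than on vectors: in this form the dual Bethe vectors fit
  the locale \<open>exchange\<close>.\<close>

definition dual_bethe :: "complex set \<Rightarrow> 'a \<Rightarrow> complex" where
  "dual_bethe W = Finite_Set.fold (\<lambda>x \<phi> a. \<phi> (T 2 1 x a)) dvac W"

lemma bethe_empty [simp]: "bethe {} = vac"
  by (simp add: bethe_def)

lemma bethe_insert: "finite W \<Longrightarrow> u \<notin> W \<Longrightarrow> bethe (insert u W) = T 1 2 u (bethe W)"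
  by (simp add: bethe_def fold_insert_commute(1)[OF comp_fun_commute_T])

lemma comp_fun_commute_dual: "comp_fun_commute (\<lambda>x \<phi> a. \<phi> (T 2 1 x a))"
  by standard (simp add: fun_eq_iff T_same_row_column_commute[OF c_nonzero])

lemma dual_bethe_empty [simp]: "dual_bethe {} = dvac"
  by (simp add: dual_bethe_def)

lemma dual_bethe_insert:
  "finite W \<Longrightarrow> x \<notin> W \<Longrightarrow> dual_bethe (insert x W) a = dual_bethe W (T 2 1 x a)"
  by (simp add: dual_bethe_def fold_insert_commute(1)[OF comp_fun_commute_dual])

lemma dual_bethe_linear:
  assumes "finite W"
  shows "dual_bethe W (a + b) = dual_bethe W a + dual_bethe W b"
    and "dual_bethe W (scl r a) = r * dual_bethe W a"
  using assms
  by (induct W arbitrary: a b)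
    (simp_all add: dual_bethe_insert T_add T_scale dvac_add dvac_scale)

lemma dual_bethe_zero: "finite W \<Longrightarrow> dual_bethe W 0 = 0"
  using dual_bethe_linear(2)[of W 0 0] by simp

lemma dual_bethe_sum: "finite W \<Longrightarrow> dual_bethe W (sum F I) = (\<Sum>i\<in>I. dual_bethe W (F i))"
  by (induct I rule: infinite_finite_induct) (simp_all add: dual_bethe_linear dual_bethe_zero)

lemma bethe_vector_eq:
  assumes "inj_on u {1..n}"
  shows "bethe_vector T vac n u = bethe (u ` {1..n})"
  unfolding bethe_vector_def bethe_def
  using foldr_eq_fold[OF comp_fun_commute_T, of "[1..<Suc n]" u] assms
  by (simp add: atLeastLessThanSuc_atLeastAtMost del: upt_Suc)

lemma dual_bethe_eq_fold: "finite W \<Longrightarrow> dual_bethe W a = dvac (Finite_Set.fold (T 2 1) a W)"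
  by (induction W arbitrary: a rule: finite_induct)
    (simp_all add: dual_bethe_insert fold_insert_commute(2)[OF comp_fun_commute_T])

lemma dual_bethe_vector_eq:
  assumes "inj_on x {1..n}"
  shows "dual_bethe_vector T dvac n x = dual_bethe (x ` {1..n})"
  unfolding dual_bethe_vector_def
  using foldr_eq_fold[OF comp_fun_commute_T, of "[1..<Suc n]" x] assms
  by (simp add: fun_eq_iff dual_bethe_eq_fold atLeastLessThanSuc_atLeastAtMost del: upt_Suc)

section \<open>The transfer matrix on Bethe vectors\<close>

lemma T11_bethe:
  assumes "finite W" "z \<notin> W"
  shows "T 1 1 z (bethe W) = scl (lam 1 z * (\<Prod>w\<in>W. ffun c w z)) (bethe W) +
    (\<Sum>w\<in>W. scl (gfun c z w * lam 1 w * (\<Prod>y\<in>W-{w}. ffun c y w)) (bethe (insert z (W - {w}))))"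
proof -
  interpret exchange scl c "T 1 1" "T 1 2" vac "lam 1"
    by standard
      (simp_all add: T_add T_scale T_same_row_column_commute[OF c_nonzero] T_diag_vac T11_T12)
  show ?thesis using A_fold[OF assms] by (simp add: bethe_def)
qed

lemma T22_bethe:
  assumes "finite W" "z \<notin> W"
  shows "T 2 2 z (bethe W) = scl (lam 2 z * (\<Prod>w\<in>W. ffun c z w)) (bethe W) +
    (\<Sum>w\<in>W. scl (gfun c w z * lam 2 w * (\<Prod>y\<in>W-{w}. ffun c w y)) (bethe (insert z (W - {w}))))"
proof -
  interpret exchange scl "- c" "T 2 2" "T 1 2" vac "lam 2"
    by standard
      (simp_all add: T_add T_scale T_same_row_column_commute[OF c_nonzero] T_diag_vac T22_T12
        ffun_neg gfun_neg)
  show ?thesis using A_fold[OF assms] by (simp add: bethe_def ffun_neg gfun_neg)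
qed

lemma vector_space_functionals: "vector_space (\<lambda>r (\<phi> :: 'a \<Rightarrow> complex) a. r * \<phi> a)"
  by standard (simp_all add: fun_eq_iff algebra_simps)

lemma dual_bethe_T11:
  assumes "finite W" "z \<notin> W"
  shows "dual_bethe W (T 1 1 z a) = lam 1 z * (\<Prod>w\<in>W. ffun c w z) * dual_bethe W a +
    (\<Sum>w\<in>W. gfun c z w * lam 1 w * (\<Prod>y\<in>W-{w}. ffun c y w) * dual_bethe (insert z (W - {w})) a)"
proof -
  interpret F: vector_space "\<lambda>r (\<phi> :: 'a \<Rightarrow> complex) a. r * \<phi> a"
    by (rule vector_space_functionals)
  interpret exchange "\<lambda>r (\<phi> :: 'a \<Rightarrow> complex) a. r * \<phi> a" c "\<lambda>z \<phi> a. \<phi> (T 1 1 z a)"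
      "\<lambda>x \<phi> a. \<phi> (T 2 1 x a)" dvac "lam 1"
    by standard
      (simp_all add: fun_eq_iff T_same_row_column_commute[OF c_nonzero] dvac_T_diag
        T21_T11 dual_bethe_linear flip: dual_bethe_def)
  show ?thesis using A_fold[OF assms, THEN fun_cong, of a]
    by (simp add: sum_fun_eval flip: dual_bethe_def)
qed

lemma dual_bethe_T22:
  assumes "finite W" "z \<notin> W"
  shows "dual_bethe W (T 2 2 z a) = lam 2 z * (\<Prod>w\<in>W. ffun c z w) * dual_bethe W a +
    (\<Sum>w\<in>W. gfun c w z * lam 2 w * (\<Prod>y\<in>W-{w}. ffun c w y) * dual_bethe (insert z (W - {w})) a)"
proof -
  interpret F: vector_space "\<lambda>r (\<phi> :: 'a \<Rightarrow> complex) a. r * \<phi> a"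
    by (rule vector_space_functionals)
  interpret exchange "\<lambda>r (\<phi> :: 'a \<Rightarrow> complex) a. r * \<phi> a" "- c" "\<lambda>z \<phi> a. \<phi> (T 2 2 z a)"
      "\<lambda>x \<phi> a. \<phi> (T 2 1 x a)" dvac "lam 2"
    by standard
      (simp_all add: fun_eq_iff T_same_row_column_commute[OF c_nonzero] dvac_T_diag
        T21_T22 dual_bethe_linear ffun_neg gfun_neg flip: dual_bethe_def)
  show ?thesis using A_fold[OF assms, THEN fun_cong, of a]
    by (simp add: sum_fun_eval ffun_neg gfun_neg flip: dual_bethe_def)
qed

text \<open>Since \<open>gfun\<close> is antisymmetric, the unwanted terms of the two diagonal
  entries combine to the Bethe defects.\<close>

lemma transfer_bethe:
  assumes "finite V" "z \<notin> V"
  shows "T 1 1 z (bethe V) + T 2 2 z (bethe V) = scl (transfer_value c lam V z) (bethe V) +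
    (\<Sum>v\<in>V. scl (gfun c z v * bethe_defect c lam V v) (bethe (insert z (V - {v}))))"
proof -
  have *: "gfun c z v * bethe_defect c lam V v =
      gfun c z v * lam 1 v * (\<Prod>y\<in>V-{v}. ffun c y v) + gfun c v z * lam 2 v * (\<Prod>y\<in>V-{v}. ffun c v y)" for v
    unfolding bethe_defect_def gfun_swap[of c v z] by (simp add: algebra_simps)
  show ?thesis
    unfolding T11_bethe[OF assms] T22_bethe[OF assms] * transfer_value_def
      scale_left_distrib sum.distrib
    by (simp add: algebra_simps)
qed

lemma transfer_dual_bethe:
  assumes "finite X" "z \<notin> X" and on_shell: "\<And>x. x \<in> X \<Longrightarrow> bethe_defect c lam X x = 0"
  shows "dual_bethe X (T 1 1 z a) + dual_bethe X (T 2 2 z a) =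
    transfer_value c lam X z * dual_bethe X a"
proof -
  have "gfun c z v * lam 1 v * (\<Prod>y\<in>X-{v}. ffun c y v) + gfun c v z * lam 2 v * (\<Prod>y\<in>X-{v}. ffun c v y)
      = gfun c z v * bethe_defect c lam X v" for v
    unfolding bethe_defect_def gfun_swap[of c v z] by (simp add: algebra_simps)
  hence "(\<Sum>v\<in>X. (gfun c z v * lam 1 v * (\<Prod>y\<in>X-{v}. ffun c y v) +
      gfun c v z * lam 2 v * (\<Prod>y\<in>X-{v}. ffun c v y)) * dual_bethe (insert z (X - {v})) a) = 0"
    by (intro sum.neutral) (simp add: on_shell)
  thus ?thesis
    unfolding dual_bethe_T11[OF assms(1,2)] dual_bethe_T22[OF assms(1,2)] transfer_value_def
    by (simp add: algebra_simps sum.distrib)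
qed

text \<open>The transfer matrix at \<open>z\<close> is placed between the two vectors. To the left
  it acts by its eigenvalue, as \<open>X\<close> is on-shell; to the right it acts by
  \<open>transfer_bethe\<close>. Equating the results relates the scalar products for the subsets of
  \<open>insert z V\<close> with one point deleted.\<close>

lemma scalar_product_exchange:
  assumes "finite X" "z \<notin> X" "\<And>x. x \<in> X \<Longrightarrow> bethe_defect c lam X x = 0"
    and "finite V" "z \<notin> V"
  shows "(transfer_value c lam X z - transfer_value c lam V z) * dual_bethe X (bethe V) =
    (\<Sum>v\<in>V. gfun c z v * bethe_defect c lam V v * dual_bethe X (bethe (insert z (V - {v}))))"
proof -
  have "transfer_value c lam X z * dual_bethe X (bethe V) =
      dual_bethe X (T 1 1 z (bethe V) + T 2 2 z (bethe V))"
    using transfer_dual_bethe[OF assms(1-3)] by (simp add: dual_bethe_linear assms(1))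
  thus ?thesis
    by (simp add: transfer_bethe[OF assms(4,5)] dual_bethe_linear dual_bethe_sum assms(1)
        left_diff_distrib)
qed

text \<open>The left-hand side is minus the quantum determinant at \<open>x + c\<close>, which is central.\<close>

lemma quantum_determinant_bethe:
  assumes "finite V" "x \<notin> V" "x + c \<notin> V"
  shows "T 1 2 (x + c) (T 2 1 x (bethe V)) - T 1 1 (x + c) (T 2 2 x (bethe V)) =
    - scl (lam 1 (x + c) * lam 2 x) (bethe V)"
  using assms
proof (induction V)
  case empty
  then show ?case by (simp add: T21_vac T_zero T_diag_vac T_scale mult.commute)
next
  case (insert v V)
  define z where "z = x + c"
  let ?b = "bethe V"
  have ne: "x \<noteq> v" "v \<noteq> x" "z \<noteq> v" "v \<noteq> z" "z \<noteq> x" "x \<noteq> z"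
    using insert.prems c_nonzero by (auto simp: z_def)
  have zx: "ffun c x z = 0" "gfun c z x = 1"
    using c_nonzero by (simp_all add: z_def ffun_def gfun_def)
  \<comment> \<open>At the separation \<open>c\<close> the coefficient f(x,z) vanishes and g(z,x) =
    1, so the two operators merely exchange their arguments.\<close>
  have sw: "T 1 1 z (T 1 2 x a) = T 1 2 z (T 1 1 x a)" for a
    using T11_T12[OF ne(5), of a] by (simp add: zx)
  have 1: "ffun c x v * ffun c v z = 1" "ffun c x v * gfun c z v = gfun c x v"
  proof -
    define d where "d = x - v"
    have d: "d \<noteq> 0" "d + c \<noteq> 0" using insert.prems by (auto simp: d_def algebra_simps)
    have "ffun c v z = (- d) / (- (d + c))"
      by (simp add: d_def z_def ffun_def algebra_simps)
    hence "ffun c v z = d / (d + c)" by (simp only: minus_divide_divide)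
    moreover have "ffun c x v = (d + c) / d"
      "gfun c x v = c / d" "gfun c z v = c / (d + c)"
      by (simp_all add: d_def z_def ffun_def gfun_def algebra_simps)
    ultimately show "ffun c x v * ffun c v z = 1" "ffun c x v * gfun c z v = gfun c x v"
      using d by simp_all
  qed
  \<comment> \<open>This expansion and the next one contain the same two terms with the factor
    g(x,v). They cancel in the difference, which leaves \<open>T 1 2 v\<close> applied to the
    induction hypothesis.\<close>
  have "T 1 2 z (T 2 1 x (T 1 2 v ?b)) = T 1 2 v (T 1 2 z (T 2 1 x ?b))
      + scl (gfun c x v) (T 1 2 z (T 1 1 v (T 2 2 x ?b)))
      - scl (gfun c x v) (T 1 2 z (T 1 1 x (T 2 2 v ?b)))"
  proof -
    have sub: "T i j u (a - b) = T i j u a - T i j u b" for i j u a b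
      using T_add[of i j u "a - b" b] by (simp add: algebra_simps)
    show ?thesis
      unfolding T21_T12[OF ne(1)] sub T_add T_scale
        T_same_row_column_commute[OF c_nonzero, of 1 2 z v] ..
  qed
  moreover have "T 1 1 z (T 2 2 x (T 1 2 v ?b)) = T 1 2 v (T 1 1 z (T 2 2 x ?b))
      + scl (gfun c x v) (T 1 2 z (T 1 1 v (T 2 2 x ?b)))
      - scl (gfun c x v) (T 1 2 z (T 1 1 x (T 2 2 v ?b)))"
    unfolding T22_T12[OF ne(1)] T_add T_scale sw T11_T12[OF ne(3)] scale_right_distrib scale_scale
      1 gfun_swap[of c v x] by simp
  ultimately have "T 1 2 z (T 2 1 x (T 1 2 v ?b)) - T 1 1 z (T 2 2 x (T 1 2 v ?b)) =
      T 1 2 v (T 1 2 z (T 2 1 x ?b)) - T 1 2 v (T 1 1 z (T 2 2 x ?b))" by simp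
  also have "\<dots> = T 1 2 v (T 1 2 z (T 2 1 x ?b) - T 1 1 z (T 2 2 x ?b))"
    using T_add[of 1 2 v "T 1 2 z (T 2 1 x ?b) - T 1 1 z (T 2 2 x ?b)" "T 1 1 z (T 2 2 x ?b)"]
    by (simp add: algebra_simps)
  also have "\<dots> = T 1 2 v (scl (- (lam 1 z * lam 2 x)) ?b)"
    using insert.IH insert.prems by (simp add: z_def)
  finally show ?case
    unfolding bethe_insert[OF insert.hyps] z_def
    by (simp only: T_scale flip: scale_minus_left)
qed

text \<open>Because \<open>lam 2\<close> vanishes at all shifted points,
  \<open>T 2 2 (x + c)\<close> annihilates the Bethe vector of the remaining ones. Then
  \<open>T 2 1 x\<close> after \<open>T 1 2 (x + c)\<close> acts as minus the quantum determinant, a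
  scalar, and the points \<open>x\<close> and \<open>x + c\<close> split off together.\<close>

lemma scalar_product_shifted:
  assumes "finite X" "\<And>x y. x \<in> X \<Longrightarrow> y \<in> X \<Longrightarrow> x - y + c \<noteq> 0" "\<And>x. x \<in> X \<Longrightarrow> lam 2 (x + c) = 0"
  shows "dual_bethe X (bethe ((\<lambda>x. x + c) ` X)) = (\<Prod>x\<in>X. - (lam 1 (x + c) * lam 2 x))"
  using assms
proof (induction X)
  case empty
  then show ?case by (simp add: dvac_vac)
next
  case (insert x X)
  let ?V = "(\<lambda>x. x + c) ` X" and ?z = "x + c"
  have fin: "finite ?V" using insert.hyps by simp
  have xV: "x \<notin> ?V"
  proof
    assume "x \<in> ?V"
    then obtain y where "y \<in> X" "y - x + c = 0" by (auto simp: algebra_simps)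
    thus False using insert.prems(1)[of y x] by auto
  qed
  have zV: "?z \<notin> ?V" using insert.hyps by auto
  have "T 2 2 ?z (bethe ?V) = 0"
    unfolding T22_bethe[OF fin zV] using insert.prems(2) by (auto intro!: sum.neutral)
  moreover have "gfun c x ?z = - 1" using c_nonzero by (simp add: gfun_def)
  moreover have "x \<noteq> ?z" using c_nonzero by simp
  ultimately have "T 2 1 x (T 1 2 ?z (bethe ?V)) = scl (- (lam 1 ?z * lam 2 x)) (bethe ?V)"
    using quantum_determinant_bethe[OF fin xV zV] by (simp add: T21_T12 T_zero algebra_simps)
  hence "dual_bethe (insert x X) (bethe (insert ?z ?V)) =
      - (lam 1 ?z * lam 2 x) * dual_bethe X (bethe ?V)"
    using insert.hyps fin zV
    by (simp only: dual_bethe_insert bethe_insert dual_bethe_linear simp_thms)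
  thus ?case using insert by simp
qed

end

section \<open>Dependence on the vacuum eigenvalues\<close>

locale two_models =
  M: generalized_model_nondeg scl c T lam vac dvac +
  N: generalized_model_nondeg scl' c T' lam' vac' dvac'
  for scl :: "complex \<Rightarrow> 'a::ab_group_add \<Rightarrow> 'a"
    and scl' :: "complex \<Rightarrow> 'b::ab_group_add \<Rightarrow> 'b"
    and c T T' lam lam' vac vac' dvac dvac'
begin

text \<open>
  Pairs of vectors of the two models that are the same linear combination of the
  Bethe vectors with parameters in \<open>W\<close>.
\<close>

inductive related :: "complex set \<Rightarrow> 'a \<Rightarrow> 'b \<Rightarrow> bool" for W where
  zero: "related W 0 0"
| add: "related W a b \<Longrightarrow> related W a' b' \<Longrightarrow> related W (a + a') (b + b')"
| scale: "related W a b \<Longrightarrow> related W (scl r a) (scl' r b)"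
| bethe: "V \<subseteq> W \<Longrightarrow> related W (M.bethe V) (N.bethe V)"

lemma related_sum: "(\<And>i. i \<in> I \<Longrightarrow> related W (F i) (G i)) \<Longrightarrow> related W (sum F I) (sum G I)"
  by (induct I rule: infinite_finite_induct) (auto intro: related.intros)

lemma related_diff: "related W a b \<Longrightarrow> related W a' b' \<Longrightarrow> related W (a - a') (b - b')"
  using related.add[OF _ related.scale[of W a' b' "-1"], of a b] by simp

lemma related_operator:
  assumes ab: "related W a b"
    and F: "\<And>a b. F (a + b) = F a + F b" "\<And>r a. F (scl r a) = scl r (F a)"
    and G: "\<And>a b. G (a + b) = G a + G b" "\<And>r a. G (scl' r a) = scl' r (G a)"
    and base: "\<And>V. V \<subseteq> W \<Longrightarrow> related W' (F (M.bethe V)) (G (N.bethe V))"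
  shows "related W' (F a) (G b)"
  using ab
proof induction
  case zero
  have "F 0 = 0" "G 0 = 0" using F(2)[of 0 0] G(2)[of 0 0] by simp_all
  then show ?case by (simp add: related.zero)
qed (auto simp: F G intro: related.intros base)

lemma related_T12:
  assumes "finite W" "u \<notin> W" "related W a b"
  shows "related (insert u W) (T 1 2 u a) (T' 1 2 u b)"
proof (rule related_operator[OF assms(3)])
  fix V assume "V \<subseteq> W"
  moreover from this assms have "finite V" "u \<notin> V" by (auto intro: finite_subset)
  ultimately have "related (insert u W) (M.bethe (insert u V)) (N.bethe (insert u V))"
    by (intro related.bethe) auto
  thus "related (insert u W) (T 1 2 u (M.bethe V)) (T' 1 2 u (N.bethe V))"
    using \<open>finite V\<close> \<open>u \<notin> V\<close> by (simp add: M.bethe_insert N.bethe_insert)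
qed (simp_all add: M.T_add M.T_scale N.T_add N.T_scale)

lemma related_T11:
  assumes "finite W" "z \<notin> W" "related W a b" and lam: "\<And>w. w \<in> insert z W \<Longrightarrow> lam 1 w = lam' 1 w"
  shows "related (insert z W) (T 1 1 z a) (T' 1 1 z b)"
proof (rule related_operator[OF assms(3)])
  fix V assume V: "V \<subseteq> W"
  with assms have "finite V" "z \<notin> V" by (auto intro: finite_subset)
  moreover have "lam 1 w = lam' 1 w" if "w \<in> insert z V" for w using lam V that by auto
  ultimately show "related (insert z W) (T 1 1 z (M.bethe V)) (T' 1 1 z (N.bethe V))"
    using V by (auto simp: M.T11_bethe N.T11_bethe
        intro!: related.add related.scale related.bethe related_sum)
qed (simp_all add: M.T_add M.T_scale N.T_add N.T_scale)

lemma related_T22: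
  assumes "finite W" "z \<notin> W" "related W a b" and lam: "\<And>w. w \<in> insert z W \<Longrightarrow> lam 2 w = lam' 2 w"
  shows "related (insert z W) (T 2 2 z a) (T' 2 2 z b)"
proof (rule related_operator[OF assms(3)])
  fix V assume V: "V \<subseteq> W"
  with assms have "finite V" "z \<notin> V" by (auto intro: finite_subset)
  moreover have "lam 2 w = lam' 2 w" if "w \<in> insert z V" for w using lam V that by auto
  ultimately show "related (insert z W) (T 2 2 z (M.bethe V)) (T' 2 2 z (N.bethe V))"
    using V by (auto simp: M.T22_bethe N.T22_bethe
        intro!: related.add related.scale related.bethe related_sum)
qed (simp_all add: M.T_add M.T_scale N.T_add N.T_scale)

lemma related_mono: "related V a b \<Longrightarrow> V \<subseteq> W \<Longrightarrow> related W a b"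
  by (induction rule: related.induct) (auto intro: related.intros)

text \<open>\<open>T 2 1 x\<close> is moved through the product by \<open>T21_T12\<close>. The
  diagonal entries that appear on the way bring in vacuum eigenvalues only at \<open>x\<close> and
  at points of \<open>V\<close>.\<close>

lemma related_T21_bethe:
  assumes "finite V" "x \<notin> V" "\<And>i w. w \<in> insert x V \<Longrightarrow> lam i w = lam' i w"
  shows "related (insert x V) (T 2 1 x (M.bethe V)) (T' 2 1 x (N.bethe V))"
  using assms
proof (induction V)
  case empty
  then show ?case by (simp add: M.T21_vac N.T21_vac related.zero)
next
  case (insert u V)
  let ?W = "insert x (insert u V)"
  have ux: "x \<noteq> u" "u \<noteq> x" using insert.prems by auto
  have bb: "related V (M.bethe V) (N.bethe V)" by (rule related.bethe) simp
  have "related (insert x V) (T 2 1 x (M.bethe V)) (T' 2 1 x (N.bethe V))"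
    using insert by auto
  hence 1: "related ?W (T 1 2 u (T 2 1 x (M.bethe V))) (T' 1 2 u (T' 2 1 x (N.bethe V)))"
    using related_T12[of "insert x V" u] insert ux by (simp add: insert_commute)
  have "related (insert x V) (T 2 2 x (M.bethe V)) (T' 2 2 x (N.bethe V))"
    using insert by (intro related_T22 bb) auto
  hence 2: "related ?W (T 1 1 u (T 2 2 x (M.bethe V))) (T' 1 1 u (T' 2 2 x (N.bethe V)))"
    using related_T11[of "insert x V" u] insert ux by (simp add: insert_commute)
  have "related (insert u V) (T 2 2 u (M.bethe V)) (T' 2 2 u (N.bethe V))"
    using insert by (intro related_T22 bb) auto
  hence 3: "related ?W (T 1 1 x (T 2 2 u (M.bethe V))) (T' 1 1 x (T' 2 2 u (N.bethe V)))"
    using related_T11[of "insert u V" x] insert by simp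
  from ux 1 2 3 show ?case
    using insert.hyps
    by (auto simp: M.bethe_insert N.bethe_insert M.T21_T12 N.T21_T12
        intro!: related_diff related.add related.scale)
qed

lemma related_T21:
  assumes "finite W" "x \<notin> W" "related W a b" "\<And>i w. w \<in> insert x W \<Longrightarrow> lam i w = lam' i w"
  shows "related (insert x W) (T 2 1 x a) (T' 2 1 x b)"
proof (rule related_operator[OF assms(3)])
  fix V assume V: "V \<subseteq> W"
  with assms have "finite V" "x \<notin> V" by (auto intro: finite_subset)
  moreover have "lam i w = lam' i w" if "w \<in> insert x V" for i w using assms(4) V that by auto
  ultimately have "related (insert x V) (T 2 1 x (M.bethe V)) (T' 2 1 x (N.bethe V))"
    by (rule related_T21_bethe)
  thus "related (insert x W) (T 2 1 x (M.bethe V)) (T' 2 1 x (N.bethe V))"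
    by (rule related_mono) (use V in auto)
qed (simp_all add: M.T_add M.T_scale N.T_add N.T_scale)

lemma related_dvac:
  assumes "related W a b" "finite W"
  shows "dvac a = dvac' b"
  using assms
proof induction
  case zero
  show ?case using M.dvac_scale[of 0 0] N.dvac_scale[of 0 0] by simp
next
  case (bethe V)
  hence "finite V" by (auto intro: finite_subset)
  show ?case
  proof (cases "V = {}")
    case False
    then obtain v A where "V = insert v A" "v \<notin> A" by (meson all_not_in_conv mk_disjoint_insert)
    with \<open>finite V\<close> show ?thesis by (simp add: M.bethe_insert N.bethe_insert M.dvac_T12 N.dvac_T12)
  qed (simp add: M.dvac_vac N.dvac_vac)
qed (simp_all add: M.dvac_add N.dvac_add M.dvac_scale N.dvac_scale)

lemma related_dual_bethe:
  assumes "finite X" "finite W" "X \<inter> W = {}" "related W a b"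
    and "\<And>i w. w \<in> X \<union> W \<Longrightarrow> lam i w = lam' i w"
  shows "M.dual_bethe X a = N.dual_bethe X b"
  using assms
proof (induction X arbitrary: W a b)
  case empty
  then show ?case using related_dvac by simp
next
  case (insert x X)
  have "related (insert x W) (T 2 1 x a) (T' 2 1 x b)"
    by (rule related_T21) (use insert.prems in auto)
  hence "M.dual_bethe X (T 2 1 x a) = N.dual_bethe X (T' 2 1 x b)"
    by (rule insert.IH[rotated 2]) (use insert.prems insert.hyps in auto)
  thus ?case using insert.hyps by (simp add: M.dual_bethe_insert N.dual_bethe_insert)
qed

text \<open>All coefficients met in the evaluation involve vacuum eigenvalues at points of
  \<open>X\<close> and \<open>V\<close> only, so a scalar product may be computed in any model that
  has the same values there.\<close>

theorem scalar_product_eq: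
  assumes "finite X" "finite V" "X \<inter> V = {}" "\<And>i w. w \<in> X \<union> V \<Longrightarrow> lam i w = lam' i w"
  shows "M.dual_bethe X (M.bethe V) = N.dual_bethe X (N.bethe V)"
  by (rule related_dual_bethe[OF assms(1-3) related.bethe assms(4)]) auto

end

section \<open>Models with prescribed vacuum eigenvalues\<close>

lemma RTT_of_components:
  fixes T :: "2 \<Rightarrow> 2 \<Rightarrow> complex \<Rightarrow> 'h::ab_group_add \<Rightarrow> 'h"
  assumes "vector_space scl"
    and add: "\<And>i j u a b. T i j u (a + b) = T i j u a + T i j u b"
    and scale: "\<And>i j u r a. T i j u (scl r a) = scl r (T i j u a)"
    and comp: "\<And>i j k l a. T i j u (T k l v a) + scl (gfun c u v) (T k j u (T i l v a)) =
      T k l v (T i j u a) + scl (gfun c u v) (T k j v (T i l u a))"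
  shows "R_op scl c u v \<circ> T_first T u \<circ> T_second T v = T_second T v \<circ> T_first T u \<circ> R_op scl c u v"
proof (intro ext)
  interpret vector_space scl by fact
  fix \<psi> :: "2 \<Rightarrow> 2 \<Rightarrow> 'h" and i k
  let ?g = "gfun c u v"
  have sum: "T i j w (sum F UNIV) = (\<Sum>l\<in>UNIV. T i j w (F l))" for i j w and F :: "2 \<Rightarrow> 'h"
    by (simp add: sum_2 add)
  have "(R_op scl c u v \<circ> T_first T u \<circ> T_second T v) \<psi> i k =
      (\<Sum>j\<in>UNIV. \<Sum>l\<in>UNIV. T i j u (T k l v (\<psi> j l)) + scl ?g (T k j u (T i l v (\<psi> j l))))"
    by (simp add: R_op_def perm_op_def T_first_def T_second_def sum scale_sum_right sum.distrib)
  also have "\<dots> = (\<Sum>j\<in>UNIV. \<Sum>l\<in>UNIV. T k l v (T i j u (\<psi> j l)) + scl ?g (T k j v (T i l u (\<psi> j l))))"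
    by (simp only: comp)
  \<comment> \<open>Exchanging the names of \<open>j\<close> and \<open>l\<close> in the second
    summand moves the permutation from the operators to the vector \<open>\<psi>\<close>.\<close>
  also have "\<dots> = (\<Sum>l\<in>UNIV. \<Sum>j\<in>UNIV. T k l v (T i j u (\<psi> j l)) + scl ?g (T k l v (T i j u (\<psi> l j))))"
    unfolding sum.distrib by (subst sum.swap) simp
  also have "\<dots> = (T_second T v \<circ> T_first T u \<circ> R_op scl c u v) \<psi> i k"
    by (simp add: R_op_def perm_op_def T_first_def T_second_def sum add scale sum.distrib)
  finally show "(R_op scl c u v \<circ> T_first T u \<circ> T_second T v) \<psi> i k =
    (T_second T v \<circ> T_first T u \<circ> R_op scl c u v) \<psi> i k" .
qed

text \<open>
  A site is a Verma module of \<open>gl(2)\<close> with basis indexed by \<open>nat\<close>; its \<open>L\<close>-operator has vacuum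
  eigenvalues \<open>u - \<alpha>\<close> and \<open>u - \<beta>\<close>. A chain of sites acts on functions of the list of the
  occupation numbers.
\<close>

definition chain_scale :: "complex \<Rightarrow> (nat list \<Rightarrow> complex) \<Rightarrow> nat list \<Rightarrow> complex" where
  "chain_scale r \<psi> = (\<lambda>ks. r * \<psi> ks)"

definition site_coeff ::
  "complex \<Rightarrow> complex \<Rightarrow> complex \<Rightarrow> 2 \<Rightarrow> 2 \<Rightarrow> complex \<Rightarrow> nat \<Rightarrow> complex" where
  "site_coeff c \<alpha> \<beta> i j u k =
    (if i = 1 then if j = 1 then u - \<alpha> - c * of_nat k else if k = 0 then 0 else 1
     else if j = 1 then of_nat (Suc k) * c * (\<beta> - \<alpha> - c * of_nat k) else u - \<beta> + c * of_nat k)"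

text \<open>The entry (1,2) reads the coordinate at \<open>k - 1\<close> and so raises the
  occupation number; the entry (2,1) lowers it. For \<open>k = 0\<close> the truncated
  \<open>k - 1\<close> is harmless, because \<open>site_coeff\<close> is 0 for the entry (1,2)
  there.\<close>

definition site_index :: "2 \<Rightarrow> 2 \<Rightarrow> nat \<Rightarrow> nat" where
  "site_index i j k = (if i = j then k else if i = 1 then k - 1 else Suc k)"

definition site_op ::
  "complex \<Rightarrow> complex \<Rightarrow> complex \<Rightarrow> 2 \<Rightarrow> 2 \<Rightarrow> complex \<Rightarrow> (nat \<Rightarrow> nat list \<Rightarrow> complex)
    \<Rightarrow> nat \<Rightarrow> nat list \<Rightarrow> complex" where
  "site_op c \<alpha> \<beta> i j u \<phi> k = chain_scale (site_coeff c \<alpha> \<beta> i j u k) (\<phi> (site_index i j k))"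

definition slice :: "(nat list \<Rightarrow> complex) \<Rightarrow> nat \<Rightarrow> nat list \<Rightarrow> complex" where
  "slice \<psi> k = (\<lambda>ks. \<psi> (k # ks))"

text \<open>The matrix product of the monodromy matrix of the old chain with the
  \<open>L\<close>-operator of a new site, which owns the first entry of the list. The empty list
  has no such entry, and the coordinate there is set to 0.\<close>

definition add_site ::
  "complex \<Rightarrow> complex \<Rightarrow> complex \<Rightarrow> (2 \<Rightarrow> 2 \<Rightarrow> complex \<Rightarrow> (nat list \<Rightarrow> complex) \<Rightarrow> nat list \<Rightarrow> complex)
    \<Rightarrow> 2 \<Rightarrow> 2 \<Rightarrow> complex \<Rightarrow> (nat list \<Rightarrow> complex) \<Rightarrow> nat list \<Rightarrow> complex" where
  "add_site c \<alpha> \<beta> T i j u \<psi> ks =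
    (case ks of [] \<Rightarrow> 0 | k # r \<Rightarrow> (\<Sum>l\<in>UNIV. T i l u (site_op c \<alpha> \<beta> l j u (slice \<psi>) k)) r)"

lemma vector_space_chain: "vector_space chain_scale"
  by standard (simp_all add: chain_scale_def fun_eq_iff algebra_simps)

lemma site_op_RTT:
  assumes "u \<noteq> v"
  shows "site_op c \<alpha> \<beta> a j u (site_op c \<alpha> \<beta> b l v \<phi>) k
      + chain_scale (gfun c u v) (site_op c \<alpha> \<beta> b j u (site_op c \<alpha> \<beta> a l v \<phi>) k) =
    site_op c \<alpha> \<beta> b l v (site_op c \<alpha> \<beta> a j u \<phi>) k
      + chain_scale (gfun c u v) (site_op c \<alpha> \<beta> b j v (site_op c \<alpha> \<beta> a l u \<phi>) k)"
proof -
  have [simp]: "(1::2) \<noteq> 2" "(2::2) \<noteq> 1" by simp_all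
  have "\<forall>a b j l. site_op c \<alpha> \<beta> a j u (site_op c \<alpha> \<beta> b l v \<phi>) k
      + chain_scale (gfun c u v) (site_op c \<alpha> \<beta> b j u (site_op c \<alpha> \<beta> a l v \<phi>) k) =
    site_op c \<alpha> \<beta> b l v (site_op c \<alpha> \<beta> a j u \<phi>) k
      + chain_scale (gfun c u v) (site_op c \<alpha> \<beta> b j v (site_op c \<alpha> \<beta> a l u \<phi>) k)"
    unfolding forall_2 using assms
    by (cases k)
      (simp_all add: fun_eq_iff site_op_def chain_scale_def site_coeff_def site_index_def gfun_def
        divide_simps, simp_all add: algebra_simps)
  thus ?thesis by blast
qed

lemma site_op_add: "site_op c \<alpha> \<beta> i j u (slice (\<psi> + \<psi>')) k =
    site_op c \<alpha> \<beta> i j u (slice \<psi>) k + site_op c \<alpha> \<beta> i j u (slice \<psi>') k"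
  and site_op_scale: "site_op c \<alpha> \<beta> i j u (slice (chain_scale r \<psi>)) k =
    chain_scale r (site_op c \<alpha> \<beta> i j u (slice \<psi>) k)"
  by (simp_all add: fun_eq_iff site_op_def slice_def chain_scale_def algebra_simps)

text \<open>Entries of the old chain commute with those of the new site, since they act on different
  coordinates. Hence the RTT relation of the product follows by applying first that of the chain and
  then that of the site. The new vacuum is the old one with the site empty.\<close>

lemma generalized_model_add_site:
  assumes "generalized_model chain_scale c T lam vac dvac"
  shows "generalized_model chain_scale c (add_site c \<alpha> \<beta> T)
    (\<lambda>i u. (if i = 1 then u - \<alpha> else u - \<beta>) * lam i u)
    (\<lambda>ks. case ks of [] \<Rightarrow> 0 | k # r \<Rightarrow> if k = 0 then vac r else 0)
    (\<lambda>\<psi>. dvac (slice \<psi> 0))"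
    (is "generalized_model _ _ ?T ?lam ?vac ?dvac")
proof -
  interpret M: generalized_model chain_scale c T lam vac dvac by fact
  let ?s = "chain_scale" and ?L = "site_op c \<alpha> \<beta>"
  have add: "?T i j u (a + b) = ?T i j u a + ?T i j u b" for i j u a b
    by (simp add: fun_eq_iff add_site_def site_op_add M.T_add sum_2 split: list.split)
  have scale: "?T i j u (?s r a) = ?s r (?T i j u a)" for i j u r a
  proof
    fix ks
    show "?T i j u (?s r a) ks = ?s r (?T i j u a) ks"
      by (cases ks) (simp_all add: add_site_def site_op_scale M.T_scale sum_2,
        simp_all add: chain_scale_def add_site_def sum_2 distrib_left)
  qed
  have slice: "slice (?T i j u \<psi>) k = (\<Sum>l\<in>UNIV. T i l u (?L l j u (slice \<psi>) k))" for i j u \<psi> k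
    by (simp add: fun_eq_iff slice_def add_site_def)
  have pull: "?L a j u (slice (?T k l v \<psi>)) p = (\<Sum>b\<in>UNIV. T k b v (?L a j u (?L b l v (slice \<psi>)) p))"
    for a j u k l v \<psi> p
    by (simp add: site_op_def[of c \<alpha> \<beta> a j u] slice M.T_scale sum_2 M.scale_right_distrib)
  have dbl: "slice (?T i j u (?T k l v \<psi>)) p =
      (\<Sum>a\<in>UNIV. \<Sum>b\<in>UNIV. T i a u (T k b v (?L a j u (?L b l v (slice \<psi>)) p)))" for i j u k l v \<psi> p
    unfolding slice pull by (simp add: sum_2 M.T_add)
  have comp: "?T i j u (?T k l v a) + ?s (gfun c u v) (?T k j u (?T i l v a)) =
      ?T k l v (?T i j u a) + ?s (gfun c u v) (?T k j v (?T i l u a))" (is "?lhs = ?rhs")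
    if uv: "u \<noteq> v" for i j k l u v a
  proof
    fix ks
    let ?g = "gfun c u v"
    show "?lhs ks = ?rhs ks"
    proof (cases ks)
      case Nil
      then show ?thesis by (simp add: add_site_def chain_scale_def)
    next
      case (Cons p r)
      let ?E = "\<lambda>a' b'. ?L a' j u (?L b' l v (slice a)) p"
      let ?F = "\<lambda>a' b'. ?L b' l v (?L a' j u (slice a)) p + ?s ?g (?L b' j v (?L a' l u (slice a)) p)"
      have "slice ?lhs p = (\<Sum>a'\<in>UNIV. \<Sum>b'\<in>UNIV.
          T i a' u (T k b' v (?E a' b')) + ?s ?g (T k a' u (T i b' v (?E a' b'))))"
        using dbl[of i j u k l v a p] dbl[of k j u i l v a p]
        by (simp add: slice_def fun_eq_iff chain_scale_def sum_2 algebra_simps)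
      also have "\<dots> = (\<Sum>a'\<in>UNIV. \<Sum>b'\<in>UNIV.
          T k b' v (T i a' u (?E a' b')) + ?s ?g (T k a' v (T i b' u (?E a' b'))))"
        by (simp only: M.RTT_component[OF uv])
      also have "\<dots> = (\<Sum>a'\<in>UNIV. \<Sum>b'\<in>UNIV.
          T k b' v (T i a' u (?E a' b')) + ?s ?g (T k b' v (T i a' u (?E b' a'))))"
        unfolding sum.distrib by (subst (4) sum.swap) simp
      also have "\<dots> = (\<Sum>a'\<in>UNIV. \<Sum>b'\<in>UNIV.
          T k b' v (T i a' u (?E a' b' + ?s ?g (?E b' a'))))"
        by (simp only: M.T_add M.T_scale)
      also have "\<dots> = (\<Sum>a'\<in>UNIV. \<Sum>b'\<in>UNIV. T k b' v (T i a' u (?F a' b')))"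
        by (simp only: site_op_RTT[OF uv])
      also have "\<dots> = (\<Sum>b'\<in>UNIV. \<Sum>a'\<in>UNIV. T k b' v (T i a' u (?L b' l v (?L a' j u (slice a)) p)))
          + (\<Sum>b'\<in>UNIV. \<Sum>a'\<in>UNIV. ?s ?g (T k b' v (T i a' u (?L b' j v (?L a' l u (slice a)) p))))"
        by (subst sum.swap) (simp add: M.T_add M.T_scale sum.distrib)
      also have "\<dots> = slice ?rhs p"
        using dbl[of k l v i j u a p] dbl[of k j v i l u a p]
        by (simp add: slice_def fun_eq_iff chain_scale_def sum_2 algebra_simps)
      finally show ?thesis using Cons by (simp add: slice_def fun_eq_iff)
    qed
  qed
  have lin: "Vector_Spaces.linear ?s ?s (?T i j u)" for i j u
    unfolding module_hom_iff_linear[symmetric]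
    using M.module_axioms by (simp add: module_hom_def module_hom_axioms_def add scale)
  have dlin: "Vector_Spaces.linear ?s (*) ?dvac"
    using M.dvac_linear unfolding module_hom_iff_linear[symmetric]
    by (simp add: module_hom_def module_hom_axioms_def slice_def plus_fun_def chain_scale_def)
  have v0: "slice ?vac = (\<lambda>k. if k = 0 then vac else 0)"
    by (simp add: slice_def fun_eq_iff)
  have s0: "?s r 0 = 0" "?s 0 a = 0" for r a by (simp_all add: chain_scale_def fun_eq_iff)
  have vac: "?T i j u ?vac ks = (case ks of [] \<Rightarrow> 0 | k # r \<Rightarrow>
      (\<Sum>l\<in>UNIV. T i l u (?L l j u (\<lambda>k. if k = 0 then vac else 0) k)) r)" for i j u ks
    unfolding add_site_def v0 ..
  have ch: "?s a \<psi> q = a * \<psi> q" for a \<psi> q by (simp add: chain_scale_def)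
  have L1: "?L l 1 u (\<lambda>k. if k = 0 then vac else 0) k = (if k = 0 \<and> l = 1 then ?s (u - \<alpha>) vac else 0)"
    and L2: "?L l 2 u (\<lambda>k. if k = 0 then vac else 0) k =
      (if k = 0 \<and> l = 2 then ?s (u - \<beta>) vac else if k = 1 \<and> l = 1 then vac else 0)" for u l k
    using exhaust_2[of l] by (auto simp: site_op_def site_coeff_def site_index_def s0)
  have tv: "?T i i u ?vac = ?s (?lam i u) ?vac" for i u
  proof
    fix ks
    have "?T 1 1 u ?vac ks = (u - \<alpha>) * lam 1 u * ?vac ks"
      unfolding vac L1 by (cases ks) (simp_all add: sum_2 M.T_zero M.T_scale M.T_diag_vac ch)
    \<comment> \<open>The term in which the site is raised is annihilated by \<open>T 2 1\<close> of
      the old chain.\<close>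
    moreover have "?T 2 2 u ?vac ks = (u - \<beta>) * lam 2 u * ?vac ks"
      unfolding vac L2
      by (cases ks) (simp_all add: sum_2 M.T_zero M.T_scale M.T_diag_vac M.T21_vac ch)
    ultimately show "?T i i u ?vac ks = ?s (?lam i u) ?vac ks"
      unfolding ch using exhaust_2[of i] by auto
  qed
  have t21: "?T 2 1 u ?vac = 0" for u
  proof
    fix ks
    show "?T 2 1 u ?vac ks = 0 ks"
      unfolding vac L1 by (cases ks) (simp_all add: sum_2 M.T_zero M.T_scale M.T21_vac s0)
  qed
  have dz: "dvac 0 = 0" using M.dvac_scale[of 0 0] by (simp only: s0 mult_zero_left)
  have L0: "?L 1 1 u \<phi> 0 = ?s (u - \<alpha>) (\<phi> 0)" "?L 1 2 u \<phi> 0 = 0"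
    "?L 2 1 u \<phi> 0 = ?s (c * (\<beta> - \<alpha>)) (\<phi> 1)" "?L 2 2 u \<phi> 0 = ?s (u - \<beta>) (\<phi> 0)" for u \<phi>
    by (simp_all add: site_op_def site_coeff_def site_index_def s0)
  have dd: "?dvac (?T i i u \<psi>) = ?lam i u * ?dvac \<psi>" for i u \<psi>
  proof -
    have "?dvac (?T 1 1 u \<psi>) = (u - \<alpha>) * lam 1 u * ?dvac \<psi>"
      unfolding slice sum_2 L0
      by (simp only: M.T_scale M.dvac_add M.dvac_scale M.dvac_T_diag M.dvac_T12) simp
    moreover have "?dvac (?T 2 2 u \<psi>) = (u - \<beta>) * lam 2 u * ?dvac \<psi>"
      unfolding slice sum_2 L0
      by (simp only: M.T_scale M.T_zero M.dvac_add M.dvac_scale M.dvac_T_diag dz) simp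
    ultimately show ?thesis using exhaust_2[of i] by auto
  qed
  have d12: "?dvac (?T 1 2 u \<psi>) = 0" for u \<psi>
    unfolding slice sum_2 L0
    by (simp only: M.T_scale M.T_zero M.dvac_add M.dvac_scale M.dvac_T12 dz) simp
  have nv: "?dvac ?vac = 1"
    unfolding v0 by (simp add: M.dvac_vac)
  have rtt: "R_op ?s c u v \<circ> T_first ?T u \<circ> T_second ?T v = T_second ?T v \<circ> T_first ?T u \<circ> R_op ?s c u v"
    if "u \<noteq> v" for u v
  proof (rule RTT_of_components[where scl = "?s" and T = "?T" and u = u and v = v and c = c])
    show "vector_space ?s" by (rule vector_space_chain)
  qed (rule add scale comp[OF that])+
  show ?thesis
    by (intro generalized_model.intro generalized_model_axioms.intro vector_space_chain)
      (fact lin dlin rtt nv tv t21 dd d12)+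
qed

lemma generalized_model_empty_chain:
  "generalized_model chain_scale c (\<lambda>i j u \<psi>. if i = j then \<psi> else 0) (\<lambda>i u. 1)
    (\<lambda>ks. if ks = [] then 1 else 0) (\<lambda>\<psi>. \<psi> [])"
proof -
  interpret V: vector_space chain_scale by (rule vector_space_chain)
  have "vector_space ((*) :: complex \<Rightarrow> complex \<Rightarrow> complex)"
    by standard (simp_all add: algebra_simps)
  hence m: "module ((*) :: complex \<Rightarrow> complex \<Rightarrow> complex)"
    by (simp add: module_iff_vector_space)
  show ?thesis
    unfolding generalized_model_def generalized_model_axioms_def module_hom_iff_linear[symmetric]
    by (intro conjI allI impI vector_space_chain RTT_of_components)
      (auto simp: module_hom_def module_hom_axioms_def V.module_axioms m chain_scale_def fun_eq_iff)
qed

lemma generalized_model_of_roots: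
  assumes "length as = length bs"
  shows "\<exists>T vac dvac. generalized_model chain_scale c T
    (\<lambda>i u. if i = 1 then (\<Prod>\<alpha>\<leftarrow>as. u - \<alpha>) else (\<Prod>\<beta>\<leftarrow>bs. u - \<beta>)) vac dvac"
  using assms
proof (induction as bs rule: list_induct2)
  case Nil
  have eq: "(\<lambda>(i::2) u. if i = 1 then \<Prod>\<alpha>\<leftarrow>[]. u - \<alpha> else \<Prod>\<beta>\<leftarrow>[]. u - \<beta>) =
      (\<lambda>i (u::complex). 1 :: complex)"
    by (intro ext) simp
  show ?case unfolding eq by (intro exI, rule generalized_model_empty_chain)
next
  case (Cons \<alpha> as \<beta> bs)
  then obtain T vac dvac where "generalized_model chain_scale c T
    (\<lambda>i u. if i = 1 then (\<Prod>\<alpha>\<leftarrow>as. u - \<alpha>) else (\<Prod>\<beta>\<leftarrow>bs. u - \<beta>)) vac dvac" by blast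
  note model = generalized_model_add_site[OF this, of \<alpha> \<beta>]
  have eq: "(\<lambda>(i::2) u. (if i = 1 then u - \<alpha> else u - \<beta>) *
        (if i = 1 then \<Prod>\<alpha>\<leftarrow>as. u - \<alpha> else \<Prod>\<beta>\<leftarrow>bs. u - \<beta>)) =
      (\<lambda>i u. if i = 1 then \<Prod>\<alpha>\<leftarrow>\<alpha> # as. u - \<alpha> else \<Prod>\<beta>\<leftarrow>\<beta> # bs. u - \<beta>)"
    by (intro ext) simp
  show ?case unfolding eq[symmetric] by (intro exI, rule model)
qed

section \<open>Monic polynomials with prescribed values\<close>

lemma monic_complex_roots:
  fixes p :: "complex poly"
  assumes "lead_coeff p = 1"
  obtains as where "length as = degree p" "\<And>u. poly p u = (\<Prod>\<alpha>\<leftarrow>as. u - \<alpha>)"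
proof -
  have "p \<noteq> 0" using assms by auto
  hence "\<exists>A. size A = degree p \<and> p = smult (lead_coeff p) (\<Prod>x\<in>#A. [:- x, 1:])"
    by (rule alg_closed_imp_factorization)
  then obtain A where A: "size A = degree p" "p = smult (lead_coeff p) (\<Prod>x\<in>#A. [:- x, 1:])"
    by (rule exE) (elim conjE, erule that)
  obtain as where as: "mset as = A" using ex_mset by blast
  have "p = (\<Prod>x\<leftarrow>as. [:- x, 1:])"
    using A(2) unfolding assms as[symmetric] by (simp flip: prod_mset_prod_list)
  moreover have "poly (\<Prod>x\<leftarrow>as. [:- x, 1:]) u = (\<Prod>\<alpha>\<leftarrow>as. u - \<alpha>)" for u
    by (induction as) (auto simp: algebra_simps)
  moreover have "length as = degree p" using A(1) as by auto
  ultimately show thesis using that[of as] by simp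
qed

text \<open>The degree is exactly \<open>card P\<close>, so that both vacuum eigenvalues have the
  same number of roots, one for each site of the chain.\<close>

lemma monic_interpolation:
  fixes a :: "complex \<Rightarrow> complex"
  assumes "finite P"
  shows "\<exists>p. lead_coeff p = 1 \<and> degree p = card P \<and> (\<forall>w\<in>P. poly p w = a w)"
  using assms
proof (induction P)
  case empty
  then show ?case by (intro exI[of _ 1]) simp
next
  case (insert w P)
  then obtain p where p: "lead_coeff p = 1" "degree p = card P" "\<forall>w\<in>P. poly p w = a w" by blast
  define q where "q = (\<Prod>v\<in>P. [:- v, 1:])"
  have monic: "lead_coeff q = 1"
    unfolding q_def lead_coeff_prod by simp
  have deg: "degree q = card P"
    unfolding q_def using degree_prod_eq_sum_degree[of P "\<lambda>v. [:- v, 1:]"] by simp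
  have q: "poly q w \<noteq> 0" "\<forall>v\<in>P. poly q v = 0"
    using insert.hyps by (auto simp: q_def poly_prod)
  \<comment> \<open>As in Newton interpolation, \<open>smult s q\<close> corrects the value at
    \<open>w\<close>; the polynomial \<open>X\<close> below vanishes on all of
    \<open>insert w P\<close> and supplies the leading term.\<close>
  define s where "s = (a w - poly p w) / poly q w"
  define r where "r = p + smult s q"
  have "degree r \<le> card P"
    unfolding r_def using p deg by (intro degree_add_le) auto
  moreover define X where "X = [:- w, 1:] * q"
  moreover have X: "degree X = Suc (card P)" "lead_coeff X = 1"
  proof -
    have "q \<noteq> 0" using q(1) by auto
    thus "degree X = Suc (card P)" unfolding X_def by (subst degree_mult_eq) (simp_all add: deg)
    show "lead_coeff X = 1" unfolding X_def lead_coeff_mult monic by simp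
  qed
  ultimately have lt: "degree r < degree X" by simp
  have "degree (r + X) = Suc (card P)" using degree_add_eq_right[OF lt] X(1) by simp
  moreover have "lead_coeff (r + X) = 1" using lead_coeff_add_le[OF lt] X(2) by simp
  moreover have "poly (r + X) v = a v" if "v \<in> insert w P" for v
    using that p(3) q unfolding r_def s_def X_def by (auto simp del: mult_pCons_left)
  ultimately show ?case
    using insert.hyps by (intro exI[of _ "r + X"]) simp
qed

theorem generalized_model_exists:
  fixes a :: "2 \<Rightarrow> complex \<Rightarrow> complex"
  assumes "finite P"
  obtains T lam vac dvac where "generalized_model chain_scale c T lam vac dvac"
    and "\<And>i w. w \<in> P \<Longrightarrow> lam i w = a i w"
proof -
  have "\<exists>as. length as = card P \<and> (\<forall>w\<in>P. (\<Prod>\<alpha>\<leftarrow>as. w - \<alpha>) = a i w)" for i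
  proof -
    obtain p where p: "lead_coeff p = 1" "degree p = card P" "\<forall>w\<in>P. poly p w = a i w"
      using monic_interpolation[OF assms] by blast
    show ?thesis by (rule monic_complex_roots[OF p(1)]) (use p in auto)
  qed
  then obtain as where as: "\<And>i. length (as i) = card P"
      "\<And>i w. w \<in> P \<Longrightarrow> (\<Prod>\<alpha>\<leftarrow>as i. w - \<alpha>) = a i w"
    using choice[of "\<lambda>i as. length as = card P \<and> (\<forall>w\<in>P. (\<Prod>\<alpha>\<leftarrow>as. w - \<alpha>) = a i w)"] by blast
  have "length (as 1) = length (as 2)" by (simp add: as(1))
  then obtain T vac dvac where model: "generalized_model chain_scale c T
      (\<lambda>i u. if i = 1 then (\<Prod>\<alpha>\<leftarrow>as 1. u - \<alpha>) else (\<Prod>\<beta>\<leftarrow>as 2. u - \<beta>)) vac dvac"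
    using generalized_model_of_roots[of "as 1" "as 2" c] by blast
  show thesis
  proof (rule that[OF model])
    fix i w assume "w \<in> P"
    thus "(if i = 1 then \<Prod>\<alpha>\<leftarrow>as 1. w - \<alpha> else \<Prod>\<beta>\<leftarrow>as 2. w - \<beta>) = a i w"
      using exhaust_2[of i] as(2) by auto
  qed
qed

section \<open>Uniqueness for the exchange relations\<close>

text \<open>The polynomial \<open>N\<close> is the numerator of the rational function with residues
  \<open>a y\<close> at the points \<open>y - c\<close>. It vanishes on \<open>X\<close> and has
  degree below \<open>card X\<close>, so it is 0; its value at \<open>y - c\<close> is
  \<open>a y\<close> times a nonzero product.\<close>

lemma cauchy_matrix_kernel:
  fixes X :: "complex set"
  assumes fin: "finite X" and ne: "\<And>x y. x \<in> X \<Longrightarrow> y \<in> X \<Longrightarrow> x - y + c \<noteq> 0"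
    and ker: "\<And>x. x \<in> X \<Longrightarrow> (\<Sum>y\<in>X. a y / (x - y + c)) = 0"
    and y: "y \<in> X"
  shows "a y = 0"
proof -
  define N where "N = (\<Sum>y\<in>X. smult (a y) (\<Prod>k\<in>X-{y}. [:c - k, 1:]))"
  have N: "poly N z = (\<Sum>y\<in>X. a y * (\<Prod>k\<in>X-{y}. z - k + c))" for z
    by (simp add: N_def poly_sum poly_prod algebra_simps)
  have "poly N x = 0" if x: "x \<in> X" for x
  proof -
    have "a y * (\<Prod>k\<in>X-{y}. x - k + c) = (\<Prod>k\<in>X. x - k + c) * (a y / (x - y + c))" if "y \<in> X" for y
      using ne[OF x that] by (simp add: prod.remove[OF fin that])
    hence "poly N x = (\<Prod>k\<in>X. x - k + c) * (\<Sum>y\<in>X. a y / (x - y + c))"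
      unfolding N sum_distrib_left by (intro sum.cong) auto
    thus ?thesis using ker[OF x] by simp
  qed
  moreover have "degree N < card X"
  proof -
    have "degree (\<Prod>k\<in>X-{y}. [:c - k, 1:]) = card X - 1" if "y \<in> X" for y
      using degree_prod_eq_sum_degree[of "X - {y}" "\<lambda>k. [:c - k, 1:]"] that by simp
    hence "degree N \<le> card X - 1"
      unfolding N_def by (intro degree_sum_le fin) (auto intro: order_trans[OF degree_smult_le])
    moreover have "card X > 0" using fin y by (auto simp: card_gt_0_iff)
    ultimately show ?thesis by linarith
  qed
  ultimately have "N = 0" by (intro poly_eqI_degree[of X]) auto
  moreover have "poly N (y - c) = a y * (\<Prod>k\<in>X-{y}. y - k)"
  proof -
    have "a k * (\<Prod>k'\<in>X-{k}. (y - c) - k' + c) = 0" if "k \<in> X - {y}" for k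
      using that y fin by (auto intro: prod_zero)
    hence "poly N (y - c) = a y * (\<Prod>k\<in>X-{y}. (y - c) - k + c)"
      unfolding N using fin y by (simp add: sum.remove sum.neutral)
    thus ?thesis by simp
  qed
  moreover have "(\<Prod>k\<in>X-{y}. y - k) \<noteq> 0" using fin by auto
  ultimately show ?thesis by simp
qed

text \<open>
  Parameters \<open>x + c\<close> with \<open>lam 2 (x + c) = 0\<close> annihilate the transfer matrix eigenvalue at
  \<open>X\<close>, and the exchange relations between them form a Cauchy system.
\<close>

lemma exchange_relation_unique:
  fixes E :: "complex set \<Rightarrow> complex"
  assumes fin: "finite X" "finite U" and c: "c \<noteq> 0"
    and X: "\<And>x y. x \<in> X \<Longrightarrow> y \<in> X \<Longrightarrow> x - y + c \<noteq> 0"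
    and U: "\<And>u x. u \<in> U \<Longrightarrow> x \<in> X \<Longrightarrow> u \<noteq> x \<and> u \<noteq> x + c"
    and lam1: "\<And>x. x \<in> X \<Longrightarrow> lam 1 (x + c) \<noteq> 0"
    and lam2: "\<And>x. x \<in> X \<Longrightarrow> lam 2 (x + c) = 0"
    and ex: "\<And>V x. V \<subseteq> U \<union> (\<lambda>x. x + c) ` X \<Longrightarrow> card V = card X \<Longrightarrow> x \<in> X \<Longrightarrow> x + c \<notin> V \<Longrightarrow>
      (transfer_value c lam X (x + c) - transfer_value c lam V (x + c)) * E V =
      (\<Sum>v\<in>V. gfun c (x + c) v * bethe_defect c lam V v * E (insert (x + c) (V - {v})))"
    and E0: "E ((\<lambda>x. x + c) ` X) = 0"
    and V: "V \<subseteq> U \<union> (\<lambda>x. x + c) ` X" "card V = card X"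
  shows "E V = 0"
  using V
\<comment> \<open>The induction is on the number of points of \<open>V\<close> that are not shifted
  points.\<close>
proof (induction "card (V \<inter> U)" arbitrary: V rule: less_induct)
  case less
  let ?S = "(\<lambda>x. x + c) ` X"
  have finS: "finite ?S" "finite (U \<union> ?S)" using fin by auto
  have cardS: "card ?S = card X" by (simp add: card_image)
  have US: "U \<inter> ?S = {}" using U by auto
  have finV: "finite V" using less.prems finS finite_subset by blast
  show ?case
  proof (cases "V \<inter> U = {}")
    case True
    with less.prems have "V \<subseteq> ?S" by auto
    hence "V = ?S" using card_subset_eq[OF finS(1)] less.prems cardS by auto
    thus ?thesis using E0 by simp
  next
    case False
    have "\<exists>x\<in>X. x + c \<notin> V"
    proof (rule ccontr)
      assume "\<not> ?thesis"
      hence "?S \<subseteq> V" by auto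
      hence "?S = V" using card_subset_eq[OF finV] less.prems cardS by auto
      thus False using False US by auto
    qed
    then obtain x0 where x0: "x0 \<in> X" "x0 + c \<notin> V" by blast
    \<comment> \<open>Deleting a point of \<open>U\<close> from \<open>W\<close> leaves fewer points
      of \<open>U\<close> than \<open>V\<close> has, so \<open>E\<close> vanishes there by
      induction. The remaining unknowns are \<open>E (W - {x + c})\<close> with \<open>x\<close> in
      \<open>Q\<close>; the case \<open>x0\<close> is \<open>E V\<close>.\<close>
    define W where "W = insert (x0 + c) V"
    define Q where "Q = {x \<in> X. x + c \<in> W}"
    have finW: "finite W" and W: "W \<subseteq> U \<union> ?S" and cardW: "card W = Suc (card X)"
      using finV less.prems x0 by (auto simp: W_def)
    have WU: "W \<inter> U = V \<inter> U" using US x0 by (auto simp: W_def)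
    have E_del: "E (W - {v}) = 0" if "v \<in> W \<inter> U" for v
    proof (rule less.hyps)
      have "(W - {v}) \<inter> U = (V \<inter> U) - {v}" using WU by auto
      thus "card ((W - {v}) \<inter> U) < card (V \<inter> U)"
        using that finV WU by (simp only:) (intro card_Diff1_less, auto)
      show "W - {v} \<subseteq> U \<union> ?S" using W by auto
      show "card (W - {v}) = card X" using that cardW finW by simp
    qed
    \<comment> \<open>With these weights the unknowns satisfy a Cauchy system: the relation at
      \<open>z\<close> gives the diagonal term through the eigenvalue of \<open>W - {z}\<close> and
      the other terms through the Bethe defects.\<close>
    define Y where "Y = (\<lambda>w. lam 1 w * (\<Prod>y\<in>W-{w}. ffun c y w) * E (W - {w}))"
    have "c * Y (x0 + c) = 0"
    proof (rule cauchy_matrix_kernel[where X = Q and a = "\<lambda>y. c * Y (y + c)"])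
      show "finite Q" using fin by (simp add: Q_def)
      show "x0 \<in> Q" using x0 by (simp add: Q_def W_def)
      show "x - y + c \<noteq> 0" if "x \<in> Q" "y \<in> Q" for x y using that X by (simp add: Q_def)
      fix x assume x: "x \<in> Q"
      define z where "z = x + c"
      define V' where "V' = W - {z}"
      have z: "z \<in> W" "z \<notin> V'" "lam 2 z = 0" "x \<in> X" using x lam2 by (auto simp: Q_def z_def V'_def)
      have V'W: "insert z (V' - {v}) = W - {v}" if "v \<in> V'" for v using that z by (auto simp: V'_def)
      have "ffun c x z = 0" using c by (simp add: z_def ffun_def)
      hence t0: "transfer_value c lam X z = 0"
        unfolding transfer_value_def using fin z by (auto intro: prod_zero)
      have tY: "transfer_value c lam V' z * E V' = Y z"
        by (simp add: transfer_value_def z Y_def V'_def)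
      have "V' \<subseteq> U \<union> ?S" "card V' = card X" using W z cardW finW by (auto simp: V'_def)
      from ex[OF this z(4), folded z_def, OF z(2)]
      have "- Y z = (\<Sum>v\<in>V'. gfun c z v * bethe_defect c lam V' v * E (W - {v}))"
        unfolding t0 using tY by (simp add: V'W)
      also have "\<dots> = (\<Sum>v\<in>(\<lambda>x. x + c) ` (Q - {x}). gfun c z v * bethe_defect c lam V' v * E (W - {v}))"
      proof (rule sum.mono_neutral_right)
        show "finite V'" using finW by (simp add: V'_def)
        show "(\<lambda>x. x + c) ` (Q - {x}) \<subseteq> V'" by (auto simp: Q_def V'_def z_def)
        show "\<forall>v\<in>V' - (\<lambda>x. x + c) ` (Q - {x}). gfun c z v * bethe_defect c lam V' v * E (W - {v}) = 0"
        proof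
          fix v assume v: "v \<in> V' - (\<lambda>x. x + c) ` (Q - {x})"
          hence "v \<in> W" "v \<noteq> z" by (auto simp: V'_def)
          moreover have "v \<notin> ?S" using v \<open>v \<in> W\<close> \<open>v \<noteq> z\<close> by (auto simp: Q_def z_def)
          ultimately have "v \<in> W \<inter> U" using W by auto
          thus "gfun c z v * bethe_defect c lam V' v * E (W - {v}) = 0" by (simp add: E_del)
        qed
      qed
      also have "\<dots> = (\<Sum>y\<in>Q-{x}. gfun c z (y + c) * bethe_defect c lam V' (y + c) * E (W - {y + c}))"
        by (subst sum.reindex) auto
      also have "\<dots> = (\<Sum>y\<in>Q-{x}. c * Y (y + c) / (x - y + c))"
      proof (rule sum.cong)
        fix y assume y: "y \<in> Q - {x}"
        define v where "v = y + c"
        have v: "v \<in> V'" "lam 2 v = 0" "v \<noteq> z" using y lam2 by (auto simp: v_def V'_def Q_def z_def)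
        have ne: "x - y + c \<noteq> 0" using X y z(4) by (auto simp: Q_def)
        have "W - {v} = insert z (V' - {v})" using V'W[OF v(1)] by simp
        hence "(\<Prod>y\<in>W-{v}. ffun c y v) = ffun c z v * (\<Prod>y\<in>V'-{v}. ffun c y v)"
          using z finW by (simp add: V'_def)
        \<comment> \<open>The factor f(z,v) completes the product over \<open>V' - {v}\<close> to
          that over \<open>W - {v}\<close>, and the Cauchy kernel is left.\<close>
        moreover have "gfun c z v = c / (x - y + c) * ffun c z v"
          using ne v(3) by (simp add: gfun_def ffun_def z_def v_def)
        ultimately show "gfun c z (y + c) * bethe_defect c lam V' (y + c) * E (W - {y + c})
            = c * Y (y + c) / (x - y + c)"
          unfolding v_def[symmetric] by (simp add: bethe_defect_def v Y_def)
      qed simp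
      finally have "Y z + (\<Sum>y\<in>Q-{x}. c * Y (y + c) / (x - y + c)) = 0" by (simp add: add_eq_0_iff)
      moreover have "finite Q" using fin by (simp add: Q_def)
      ultimately show "(\<Sum>y\<in>Q. c * Y (y + c) / (x - y + c)) = 0"
        using x c by (simp add: sum.remove z_def)
    qed
    moreover have "W - {x0 + c} = V" using x0 by (auto simp: W_def)
    moreover have "ffun c y (x0 + c) \<noteq> 0" if "y \<in> V" for y
    proof -
      have "y - x0 \<noteq> 0"
        using that less.prems U[OF _ x0(1)] X[OF _ x0(1)] by (auto simp: algebra_simps)
      thus ?thesis using that x0 by (auto simp: ffun_def)
    qed
    ultimately show ?thesis using c lam1[OF x0(1)] finV by (auto simp: Y_def)
  qed
qed

section \<open>The determinant\<close>

text \<open>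
  Up to a sign this is \<open>det (F\<^sub>i (v\<^sub>j))\<close> times the product of \<open>gfun c v\<^sub>i v\<^sub>j\<close> over \<open>i < j\<close>. Both factors are
  antisymmetric, so the product depends on the set \<open>V\<close> only; the recursion is the expansion along \<open>F\<close>.
\<close>

primrec alternating_sum :: "complex \<Rightarrow> (complex \<Rightarrow> complex) list \<Rightarrow> complex set \<Rightarrow> complex" where
  "alternating_sum c [] V = 1"
| "alternating_sum c (F # Fs) V =
     (\<Sum>v\<in>V. F v * (\<Prod>w\<in>V-{v}. gfun c w v) * alternating_sum c Fs (V - {v}))"

lemma alternating_sum_cong_hd:
  "(\<And>v. v \<in> V \<Longrightarrow> F v = G v) \<Longrightarrow> alternating_sum c (F # Fs) V = alternating_sum c (G # Fs) V"
  by simp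

lemma alternating_sum_linear_hd:
  "alternating_sum c ((\<lambda>v. \<Sum>k\<in>K. a k * F k v) # Fs) V =
     (\<Sum>k\<in>K. a k * alternating_sum c (F k # Fs) V)"
  unfolding alternating_sum.simps sum_distrib_left sum_distrib_right
  by (subst sum.swap) (simp add: mult.assoc)

text \<open>Removing \<open>v\<close> and then \<open>w\<close>, or \<open>w\<close> and then
  \<open>v\<close>, produces the same factors except that g(w,v) becomes g(v,w), which changes the
  sign.\<close>

lemma alternating_sum_swap:
  assumes "finite V"
  shows "alternating_sum c (F # G # Fs) V = - alternating_sum c (G # F # Fs) V"
proof -
  define H where "H = (\<lambda>v w. (\<Prod>y\<in>V-{v}. gfun c y v) * (\<Prod>y\<in>V-{v}-{w}. gfun c y w)
      * alternating_sum c Fs (V - {v} - {w}))"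
  have *: "alternating_sum c (F # G # Fs) V = (\<Sum>v\<in>V. \<Sum>w\<in>{w\<in>V. v \<noteq> w}. F v * G w * H v w)" for F G
  proof -
    have "{w \<in> V. v \<noteq> w} = V - {v}" for v by auto
    thus ?thesis by (simp add: H_def sum_distrib_left mult_ac)
  qed
  have H: "H v w = - H w v" if "v \<in> V" "w \<in> V" "v \<noteq> w" for v w
  proof -
    have "(\<Prod>y\<in>V-{v}. gfun c y v) = gfun c w v * (\<Prod>y\<in>V-{v}-{w}. gfun c y v)"
      "(\<Prod>y\<in>V-{w}. gfun c y w) = gfun c v w * (\<Prod>y\<in>V-{w}-{v}. gfun c y w)"
      using that assms prod.remove[of "V - {v}" w "\<lambda>y. gfun c y v"]
        prod.remove[of "V - {w}" v "\<lambda>y. gfun c y w"] by auto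
    moreover have "V - {w} - {v} = V - {v} - {w}" by auto
    ultimately show ?thesis by (simp add: H_def gfun_swap[of c w v])
  qed
  have "alternating_sum c (F # G # Fs) V = (\<Sum>w\<in>V. \<Sum>v\<in>{v\<in>V. v \<noteq> w}. F v * G w * H v w)"
    unfolding * by (rule sum.swap_restrict[OF assms assms])
  also have "\<dots> = (\<Sum>w\<in>V. \<Sum>v\<in>{v\<in>V. w \<noteq> v}. - (G w * F v * H w v))"
  proof (intro sum.cong)
    fix w v assume "w \<in> V" "v \<in> {v \<in> V. w \<noteq> v}"
    hence "H v w = - H w v" by (intro H) auto
    thus "F v * G w * H v w = - (G w * F v * H w v)" by (simp add: mult.commute)
  qed auto
  also have "\<dots> = - alternating_sum c (G # F # Fs) V"
    unfolding * by (simp add: sum_negf)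
  finally show ?thesis .
qed

text \<open>The first column is carried inwards by \<open>alternating_sum_swap\<close> until it
  meets its copy, where antisymmetry forces the value 0.\<close>

lemma alternating_sum_repeated:
  "finite V \<Longrightarrow> F \<in> set Fs \<Longrightarrow> alternating_sum c (F # Fs) V = 0"
proof (induction Fs arbitrary: V)
  case (Cons G Gs)
  show ?case
  proof (cases "F = G")
    case True
    then show ?thesis using alternating_sum_swap[OF Cons.prems(1), of c F F Gs] by simp
  next
    case False
    with Cons.prems Cons.IH have "alternating_sum c (F # Gs) (V - {v}) = 0" for v by simp
    hence "alternating_sum c (G # F # Gs) V = 0"
      by (simp only: alternating_sum.simps(2)[of c G] mult_zero_right sum.neutral_const)
    thus ?thesis using alternating_sum_swap[OF Cons.prems(1), of c F G Gs] by simp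
  qed
qed simp

text \<open>Lagrange interpolation on \<open>X\<close>: the two monic products have equal degree, so
  their difference has degree below \<open>card X\<close> and is determined by its values on
  \<open>X\<close>, where the product over \<open>X\<close> vanishes.\<close>

lemma monic_product_expansion:
  fixes A X :: "complex set"
  assumes "finite A" "finite X" "card A = card X"
  shows "(\<Prod>a\<in>A. z - a) = (\<Prod>x\<in>X. z - x) +
    (\<Sum>k\<in>X. (\<Prod>a\<in>A. k - a) / (\<Prod>i\<in>X-{k}. k - i) * (\<Prod>i\<in>X-{k}. z - i))"
proof -
  define p where "p = (\<lambda>A :: complex set. \<Prod>a\<in>A. [:- a, 1:])"
  have p: "degree (p A) = card A" "coeff (p A) (card A) = 1" "poly (p A) z = (\<Prod>a\<in>A. z - a)" for A z
  proof -
    show d: "degree (p A) = card A"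
      unfolding p_def using degree_prod_eq_sum_degree[of A "\<lambda>a. [:- a, 1:]"] by simp
    have "lead_coeff (p A) = 1" unfolding p_def lead_coeff_prod by simp
    thus "coeff (p A) (card A) = 1" by (simp add: d)
    show "poly (p A) z = (\<Prod>a\<in>A. z - a)" by (simp add: p_def poly_prod)
  qed
  define q where "q = (\<Sum>k\<in>X. smult ((\<Prod>a\<in>A. k - a) / (\<Prod>i\<in>X-{k}. k - i)) (p (X - {k})))"
  have q: "poly q z = (\<Sum>k\<in>X. (\<Prod>a\<in>A. k - a) / (\<Prod>i\<in>X-{k}. k - i) * (\<Prod>i\<in>X-{k}. z - i))" for z
    by (simp add: q_def poly_sum p)
  have qc: "coeff q j = 0" if "j \<ge> card X" for j
    unfolding q_def coeff_sum
  proof (intro sum.neutral ballI)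
    fix k assume k: "k \<in> X"
    have "card (X - {k}) < card X" using k assms(2) by (rule card_Diff1_less[rotated])
    hence "coeff (p (X - {k})) j = 0" using that by (intro coeff_eq_0) (simp add: p)
    thus "coeff (smult ((\<Prod>a\<in>A. k - a) / (\<Prod>i\<in>X-{k}. k - i)) (p (X - {k}))) j = 0" by simp
  qed
  have "p A = p X + q"
  proof (rule poly_eqI_degree_lead_coeff[where n = "card X" and A = X])
    show "coeff (p A) (card X) = coeff (p X + q) (card X)"
      using p(2)[of A] p(2)[of X] qc[of "card X"] assms(3) by simp
    show "degree (p A) \<le> card X" by (simp add: p assms)
    show "degree (p X + q) \<le> card X"
      by (intro degree_add_le degree_le) (auto simp: p qc coeff_eq_0)
    fix x assume x: "x \<in> X"
    have "poly (p X) x = 0" using x assms by (auto simp: p)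
    moreover have "poly q x = (\<Prod>a\<in>A. x - a)"
    proof -
      have "(\<Prod>i\<in>X-{k}. x - i) = 0" if "k \<in> X - {x}" for k
        using that x assms(2) by (intro prod_zero) auto
      hence "(\<Sum>k\<in>X-{x}. (\<Prod>a\<in>A. k - a) / (\<Prod>i\<in>X-{k}. k - i) * (\<Prod>i\<in>X-{k}. x - i)) = 0"
        by (intro sum.neutral) simp
      moreover have "(\<Prod>i\<in>X-{x}. x - i) \<noteq> 0" using assms(2) by auto
      ultimately show ?thesis unfolding q sum.remove[OF assms(2) x] by simp
    qed
    ultimately show "poly (p A) x = poly (p X + q) x" by (simp add: p)
  qed auto
  from arg_cong[OF this, of "\<lambda>p. poly p z"] show ?thesis by (simp add: p q)
qed

text \<open>Splitting \<open>d / (y - k)\<close> as \<open>(y + d - k) / (y - k) - 1\<close> turns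
  each summand into a difference of terms of \<open>monic_product_expansion\<close> at
  \<open>y\<close> and at \<open>y + d\<close>.\<close>

lemma shifted_product_expansion:
  fixes A X :: "complex set"
  assumes "finite A" "finite X" "card A = card X" "y \<notin> X"
  shows "d * (\<Sum>k\<in>X. (\<Prod>a\<in>A. k - a) / (\<Prod>i\<in>X-{k}. k - i) * (\<Prod>i\<in>X-{k}. y + d - i) / (y - k)) =
    (\<Prod>x\<in>X. y + d - x) * (\<Prod>a\<in>A. y - a) / (\<Prod>x\<in>X. y - x) - (\<Prod>a\<in>A. y + d - a)"
proof -
  define \<alpha> where "\<alpha> = (\<lambda>k. (\<Prod>a\<in>A. k - a) / (\<Prod>i\<in>X-{k}. k - i))"
  let ?X = "\<lambda>z. \<Prod>x\<in>X. z - x"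
  have exp: "(\<Prod>a\<in>A. z - a) = ?X z + (\<Sum>k\<in>X. \<alpha> k * (\<Prod>i\<in>X-{k}. z - i))" for z
    unfolding \<alpha>_def by (rule monic_product_expansion[OF assms(1-3)])
  have X0: "?X y \<noteq> 0" using assms by auto
  have 1: "d * (\<alpha> k * (\<Prod>i\<in>X-{k}. y + d - i) / (y - k)) =
      ?X (y + d) / ?X y * (\<alpha> k * (\<Prod>i\<in>X-{k}. y - i)) - \<alpha> k * (\<Prod>i\<in>X-{k}. y + d - i)" if "k \<in> X" for k
  proof -
    have "y - k \<noteq> 0" "(\<Prod>i\<in>X-{k}. y - i) \<noteq> 0" using that assms by auto
    moreover have "?X y = (y - k) * (\<Prod>i\<in>X-{k}. y - i)"
      "?X (y + d) = (y + d - k) * (\<Prod>i\<in>X-{k}. y + d - i)"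
      using that assms(2) by (simp_all add: prod.remove)
    ultimately show ?thesis by (simp add: divide_simps) (simp add: algebra_simps)
  qed
  have "d * (\<Sum>k\<in>X. \<alpha> k * (\<Prod>i\<in>X-{k}. y + d - i) / (y - k)) =
      ?X (y + d) / ?X y * (\<Sum>k\<in>X. \<alpha> k * (\<Prod>i\<in>X-{k}. y - i)) - (\<Sum>k\<in>X. \<alpha> k * (\<Prod>i\<in>X-{k}. y + d - i))"
    unfolding sum_distrib_left sum_subtractf[symmetric] by (rule sum.cong) (simp_all only: 1)
  also have "\<dots> = ?X (y + d) / ?X y * ((\<Prod>a\<in>A. y - a) - ?X y) - ((\<Prod>a\<in>A. y + d - a) - ?X (y + d))"
    using exp[of y] exp[of "y + d"] by simp
  also have "\<dots> = ?X (y + d) * (\<Prod>a\<in>A. y - a) / ?X y - (\<Prod>a\<in>A. y + d - a)"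
    using X0 by (simp add: field_simps)
  finally show ?thesis by (simp add: \<alpha>_def)
qed

text \<open>The closed form of J(y,k) in terms of the set \<open>X\<close>. The two products consist
  of the factors h(y,i) and -h(i,y); those for i = k have cancelled against the denominators of
  t.\<close>

definition slavnov_column ::
  "complex \<Rightarrow> (2 \<Rightarrow> complex \<Rightarrow> complex) \<Rightarrow> complex set \<Rightarrow> complex \<Rightarrow> complex \<Rightarrow> complex" where
  "slavnov_column c lam X k y = gfun c y k *
    (lam 2 y * (\<Prod>i\<in>X-{k}. (y - i + c) / c) - lam 1 y * (\<Prod>i\<in>X-{k}. (y - i - c) / c))"

text \<open>Multiplied by \<open>gfun c a y\<close> for all \<open>a\<close> in \<open>A\<close>
  other than \<open>y\<close>, it becomes, up to a constant, the difference of the eigenvalues of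
  \<open>X\<close> and \<open>A\<close> if \<open>y\<close> lies outside \<open>A\<close>, and the
  Bethe defect of \<open>A\<close> if \<open>y\<close> belongs to \<open>A\<close>. These are the
  coefficients of the exchange relations.\<close>

definition exchange_column ::
  "complex \<Rightarrow> (2 \<Rightarrow> complex \<Rightarrow> complex) \<Rightarrow> complex set \<Rightarrow> complex set \<Rightarrow> complex \<Rightarrow> complex" where
  "exchange_column c lam X A y = (\<Prod>a\<in>A. y - a) * transfer_value c lam X y
    - lam 2 y * (\<Prod>a\<in>A. y - a + c) - lam 1 y * (\<Prod>a\<in>A. y - a - c)"

text \<open>The parts with \<open>lam 2\<close> and \<open>lam 1\<close> are
  \<open>shifted_product_expansion\<close> for \<open>d = c\<close> and \<open>d = - c\<close>. The
  coefficients of the Slavnov columns do not depend on \<open>y\<close>, so the identity is one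
  between columns.\<close>

lemma exchange_column_expansion:
  assumes "c \<noteq> 0" "finite A" "finite X" "card A = card X" "y \<notin> X"
  shows "(\<Sum>k\<in>X. (\<Prod>a\<in>A. k - a) * (\<Prod>i\<in>X-{k}. gfun c k i) * slavnov_column c lam X k y) =
    exchange_column c lam X A y"
proof -
  define \<alpha> where "\<alpha> = (\<lambda>k. (\<Prod>a\<in>A. k - a) / (\<Prod>i\<in>X-{k}. k - i))"
  have trm: "(\<Prod>a\<in>A. k - a) * (\<Prod>i\<in>X-{k}. gfun c k i) * slavnov_column c lam X k y =
      lam 2 y * (c * (\<alpha> k * (\<Prod>i\<in>X-{k}. y + c - i) / (y - k))) +
      lam 1 y * (- c * (\<alpha> k * (\<Prod>i\<in>X-{k}. y + - c - i) / (y - k)))" for k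
  proof -
    have alg: "p * (q / r) * (c / e * (a * (s / q) - b * (t / q))) =
        a * (c * (p / r * s / e)) + b * (- c * (p / r * t / e))" if "q \<noteq> 0" for a b e p q r s t
      using that by (cases "r = 0"; cases "e = 0") (simp_all add: field_simps)
    have e: "y - i + c = y + c - i" "y - i - c = y + - c - i" for i by simp_all
    show ?thesis
      unfolding slavnov_column_def gfun_def \<alpha>_def e prod_dividef prod_constant
      by (rule alg) (simp add: assms(1))
  qed
  have X: "(\<Prod>x\<in>X. y + c - x) / (\<Prod>x\<in>X. y - x) = (\<Prod>x\<in>X. ffun c y x)"
    "(\<Prod>x\<in>X. y + - c - x) / (\<Prod>x\<in>X. y - x) = (\<Prod>x\<in>X. ffun c x y)"
  proof -
    have "(y + - c - x) / (y - x) = ffun c x y" for x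
      unfolding ffun_def by (metis minus_diff_eq minus_divide_divide minus_add_distrib
          minus_minus diff_add_eq uminus_add_conv_diff add.commute diff_conv_add_uminus)
    thus "(\<Prod>x\<in>X. y + - c - x) / (\<Prod>x\<in>X. y - x) = (\<Prod>x\<in>X. ffun c x y)"
      by (simp only: prod_dividef[symmetric])
    show "(\<Prod>x\<in>X. y + c - x) / (\<Prod>x\<in>X. y - x) = (\<Prod>x\<in>X. ffun c y x)"
      by (simp add: prod_dividef[symmetric] ffun_def algebra_simps)
  qed
  have "(\<Sum>k\<in>X. (\<Prod>a\<in>A. k - a) * (\<Prod>i\<in>X-{k}. gfun c k i) * slavnov_column c lam X k y) =
      lam 2 y * (c * (\<Sum>k\<in>X. \<alpha> k * (\<Prod>i\<in>X-{k}. y + c - i) / (y - k))) +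
      lam 1 y * (- c * (\<Sum>k\<in>X. \<alpha> k * (\<Prod>i\<in>X-{k}. y + - c - i) / (y - k)))"
    unfolding trm sum.distrib sum_distrib_left ..
  also have "\<dots> = lam 2 y * ((\<Prod>x\<in>X. ffun c y x) * (\<Prod>a\<in>A. y - a) - (\<Prod>a\<in>A. y + c - a)) +
     lam 1 y * ((\<Prod>x\<in>X. ffun c x y) * (\<Prod>a\<in>A. y - a) - (\<Prod>a\<in>A. y + - c - a))"
  proof -
    have "d * (\<Sum>k\<in>X. \<alpha> k * (\<Prod>i\<in>X-{k}. y + d - i) / (y - k)) =
      (\<Prod>x\<in>X. y + d - x) / (\<Prod>x\<in>X. y - x) * (\<Prod>a\<in>A. y - a) - (\<Prod>a\<in>A. y + d - a)" for d
      using shifted_product_expansion[OF assms(2-5), of d] by (simp add: \<alpha>_def)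
    note this[of c] this[of "- c"]
    thus ?thesis by (simp only: X)
  qed
  also have "\<dots> = exchange_column c lam X A y"
    by (simp add: exchange_column_def transfer_value_def algebra_simps)
  finally show ?thesis .
qed

lemma gfun_mult:
  assumes "a \<noteq> z"
  shows "(z - a) * gfun c a z = - c" "(z - a + c) * gfun c a z = - c * ffun c z a"
    "(z - a - c) * gfun c a z = - c * ffun c a z"
proof -
  define d where "d = a - z"
  have d: "d \<noteq> 0" "z - a = - d" "a - z = d" using assms by (auto simp: d_def)
  show "(z - a) * gfun c a z = - c" "(z - a + c) * gfun c a z = - c * ffun c z a"
    "(z - a - c) * gfun c a z = - c * ffun c a z"
    unfolding gfun_def ffun_def d(2,3) using d(1) by (simp_all add: field_simps)
qed

lemma ffun_factor:
  assumes "c \<noteq> 0" "v \<noteq> y"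
  shows "ffun c v y = gfun c v y * ((v - y + c) / c)" "ffun c y v = gfun c v y * ((v - y - c) / c)"
proof -
  show "ffun c v y = gfun c v y * ((v - y + c) / c)"
    using assms(1) by (simp add: gfun_def ffun_def)
  have "c * (gfun c v y * ((v - y - c) / c)) = c * ffun c y v"
    using assms(1) gfun_mult(3)[of y v c] gfun_swap[of c v y] assms(2) by (simp add: mult.commute)
  thus "ffun c y v = gfun c v y * ((v - y - c) / c)" using assms(1) by simp
qed

lemma prod_gfun_mult:
  assumes "\<And>a. a \<in> V \<Longrightarrow> a \<noteq> z"
  shows "(\<Prod>a\<in>V. z - a) * (\<Prod>a\<in>V. gfun c a z) = (- c) ^ card V"
    and "(\<Prod>a\<in>V. z - a + c) * (\<Prod>a\<in>V. gfun c a z) = (- c) ^ card V * (\<Prod>a\<in>V. ffun c z a)"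
    and "(\<Prod>a\<in>V. z - a - c) * (\<Prod>a\<in>V. gfun c a z) = (- c) ^ card V * (\<Prod>a\<in>V. ffun c a z)"
  unfolding prod_constant[symmetric] prod.distrib[symmetric]
  by (rule prod.cong[OF refl], simp only: gfun_mult[OF assms])+

lemma exchange_column_outside:
  assumes "finite V" "z \<notin> V"
  shows "exchange_column c lam X V z * (\<Prod>a\<in>V. gfun c a z) =
    (- c) ^ card V * (transfer_value c lam X z - transfer_value c lam V z)"
proof -
  have "a \<noteq> z" if "a \<in> V" for a using that assms(2) by auto
  note 1 = prod_gfun_mult[where V = V and c = c, OF this]
  have "(p * t - l2 * q - l1 * r) * g = t * (p * g) - l2 * (q * g) - l1 * (r * g)"
    for p t l2 q l1 r g :: complex by (simp add: algebra_simps)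
  thus ?thesis
    unfolding exchange_column_def
    by (simp only: 1) (simp add: transfer_value_def algebra_simps)
qed

lemma exchange_column_inside:
  assumes "finite V" "v \<in> V"
  shows "exchange_column c lam X V v * (\<Prod>a\<in>V-{v}. gfun c a v) =
    - ((- c) ^ card V * bethe_defect c lam V v)"
proof -
  have "a \<noteq> v" if "a \<in> V - {v}" for a using that by auto
  note 1 = prod_gfun_mult[where V = "V - {v}" and c = c, OF this]
  have card: "card (V - {v}) = card V - 1" using assms by simp
  have "exchange_column c lam X V v =
      - c * (lam 2 v * (\<Prod>a\<in>V-{v}. v - a + c) - lam 1 v * (\<Prod>a\<in>V-{v}. v - a - c))"
    using assms by (simp add: exchange_column_def prod.remove algebra_simps)
  hence "exchange_column c lam X V v * (\<Prod>a\<in>V-{v}. gfun c a v) =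
      - c * (lam 2 v * ((\<Prod>a\<in>V-{v}. v - a + c) * (\<Prod>a\<in>V-{v}. gfun c a v))
        - lam 1 v * ((\<Prod>a\<in>V-{v}. v - a - c) * (\<Prod>a\<in>V-{v}. gfun c a v)))"
  proof -
    assume e: "exchange_column c lam X V v =
      - c * (lam 2 v * (\<Prod>a\<in>V-{v}. v - a + c) - lam 1 v * (\<Prod>a\<in>V-{v}. v - a - c))"
    have "- c * (l2 * q - l1 * r) * g = - c * (l2 * (q * g) - l1 * (r * g))"
      for l2 q l1 r g :: complex by (simp add: algebra_simps)
    thus ?thesis unfolding e .
  qed
  also have "\<dots> = - ((- c * (- c) ^ (card V - 1)) * bethe_defect c lam V v)"
    by (simp only: 1 card bethe_defect_def) (simp add: algebra_simps)
  also have "- c * (- c) ^ (card V - 1) = (- c) ^ card V"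
    using assms by (metis card_gt_0_iff empty_iff power_minus_mult mult.commute)
  finally show ?thesis .
qed

lemma alternating_sum_cong:
  "(\<And>k v. k \<in> set ks \<Longrightarrow> v \<in> V \<Longrightarrow> F k v = G k v) \<Longrightarrow>
    alternating_sum c (map F ks) V = alternating_sum c (map G ks) V"
proof (induction ks arbitrary: V)
  case (Cons k ks)
  have "alternating_sum c (map F ks) (V - {v}) = alternating_sum c (map G ks) (V - {v})" for v
    by (rule Cons.IH) (use Cons.prems in auto)
  then show ?case using Cons.prems by simp
qed simp

text \<open>
  By \<open>exchange_column_expansion\<close>, prepending the exchange column gives a sum of alternating
  sums with a repeated column.
\<close>

lemma slavnov_exchange:
  assumes "c \<noteq> 0" "set xs = X" "finite V" "card V = card X" "z \<notin> V" "insert z V \<inter> X = {}"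
  shows "(transfer_value c lam X z - transfer_value c lam V z) *
      alternating_sum c (map (slavnov_column c lam X) xs) V =
    (\<Sum>v\<in>V. gfun c z v * bethe_defect c lam V v *
      alternating_sum c (map (slavnov_column c lam X) xs) (insert z (V - {v})))"
proof -
  let ?W = "insert z V" and ?cols = "map (slavnov_column c lam X) xs"
  define D where "D = alternating_sum c ?cols"
  have finX: "finite X" using assms(2) by auto
  have "alternating_sum c (exchange_column c lam X V # ?cols) ?W =
      alternating_sum c ((\<lambda>v. \<Sum>k\<in>X. ((\<Prod>a\<in>V. k - a) * (\<Prod>i\<in>X-{k}. gfun c k i)) *
        slavnov_column c lam X k v) # ?cols) ?W"
    using assms finX
    by (intro alternating_sum_cong_hd exchange_column_expansion[symmetric]) auto
  also have "\<dots> = 0"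
    unfolding alternating_sum_linear_hd using assms
    by (intro sum.neutral) (simp add: alternating_sum_repeated del: alternating_sum.simps)
  \<comment> \<open>Expansion along the exchange column: its value at \<open>z\<close> yields the
    left-hand side and its values on \<open>V\<close> the right-hand side.\<close>
  finally have "0 = (\<Sum>w\<in>?W. exchange_column c lam X V w * (\<Prod>a\<in>?W-{w}. gfun c a w) * D (?W - {w}))"
    by (simp add: D_def)
  also have "\<dots> = exchange_column c lam X V z * (\<Prod>a\<in>V. gfun c a z) * D V +
      (\<Sum>v\<in>V. exchange_column c lam X V v * (\<Prod>a\<in>?W-{v}. gfun c a v) * D (?W - {v}))"
    using assms by simp
  also have "(\<Sum>v\<in>V. exchange_column c lam X V v * (\<Prod>a\<in>?W-{v}. gfun c a v) * D (?W - {v})) =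
      (\<Sum>v\<in>V. - ((- c) ^ card V) * (gfun c z v * bethe_defect c lam V v * D (insert z (V - {v}))))"
  proof (rule sum.cong)
    fix v assume v: "v \<in> V"
    have W: "?W - {v} = insert z (V - {v})" using v assms(5) by auto
    have "exchange_column c lam X V v * (\<Prod>a\<in>?W-{v}. gfun c a v) =
        gfun c z v * (exchange_column c lam X V v * (\<Prod>a\<in>V-{v}. gfun c a v))"
      unfolding W using assms(3,5) by simp
    thus "exchange_column c lam X V v * (\<Prod>a\<in>?W-{v}. gfun c a v) * D (?W - {v}) =
        - ((- c) ^ card V) * (gfun c z v * bethe_defect c lam V v * D (insert z (V - {v})))"
      unfolding exchange_column_inside[OF assms(3) v] W by simp
  qed simp
  also have "exchange_column c lam X V z * (\<Prod>a\<in>V. gfun c a z) * D V =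
      (- c) ^ card V * ((transfer_value c lam X z - transfer_value c lam V z) * D V)"
    using exchange_column_outside[OF assms(3,5)] by simp
  finally have "(- c) ^ card V * ((transfer_value c lam X z - transfer_value c lam V z) * D V) =
      (- c) ^ card V * (\<Sum>v\<in>V. gfun c z v * bethe_defect c lam V v * D (insert z (V - {v})))"
    by (simp add: sum_distrib_left sum_negf)
  thus ?thesis using assms(1) by (simp add: D_def)
qed

section \<open>The shifted points and the Slavnov formula\<close>

primrec delta_list :: "complex \<Rightarrow> complex list \<Rightarrow> complex" where
  "delta_list c [] = 1"
| "delta_list c (x # xs) = (\<Prod>y\<in>set xs. gfun c x y) * delta_list c xs"

text \<open>One term of each expansion survives. Its factors g(y,x), one for each pair, are
  completed by \<open>delta_list\<close> to the product over all ordered pairs.\<close>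

lemma alternating_sum_diagonal:
  assumes "distinct xs"
    and "\<And>x y. x \<in> set xs \<Longrightarrow> y \<in> set xs \<Longrightarrow> x \<noteq> y \<Longrightarrow> F x (y + c) = 0"
  shows "delta_list c xs * alternating_sum c (map F xs) ((\<lambda>x. x + c) ` set xs) =
    (\<Prod>x\<in>set xs. F x (x + c) * (\<Prod>y\<in>set xs-{x}. gfun c x y))"
  using assms
proof (induction xs)
  case (Cons x xs)
  let ?S = "(\<lambda>x. x + c) ` set xs" and ?A = "alternating_sum c (map F xs)"
  have x: "x + c \<notin> ?S" using Cons.prems by auto
  have "alternating_sum c (map F (x # xs)) (insert (x + c) ?S) =
      F x (x + c) * (\<Prod>w\<in>?S. gfun c w (x + c)) * ?A ?S"
  proof -
    have "F x v * (\<Prod>w\<in>insert (x + c) ?S-{v}. gfun c w v) * ?A (insert (x + c) ?S - {v}) = 0"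
      if "v \<in> ?S" for v using that Cons.prems by auto
    thus ?thesis using x by (simp add: sum.neutral)
  qed
  also have "(\<Prod>w\<in>?S. gfun c w (x + c)) = (\<Prod>y\<in>set xs. gfun c y x)"
    by (subst prod.reindex) (auto simp: gfun_def)
  finally have "delta_list c (x # xs) * alternating_sum c (map F (x # xs)) (insert (x + c) ?S) =
      F x (x + c) * (\<Prod>y\<in>set xs. gfun c x y) * (\<Prod>y\<in>set xs. gfun c y x) * (delta_list c xs * ?A ?S)"
    by simp
  also have "delta_list c xs * ?A ?S = (\<Prod>y\<in>set xs. F y (y + c) * (\<Prod>z\<in>set xs-{y}. gfun c y z))"
    using Cons by simp
  also have "F x (x + c) * (\<Prod>y\<in>set xs. gfun c x y) * (\<Prod>y\<in>set xs. gfun c y x) * \<dots> =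
      F x (x + c) * (\<Prod>y\<in>set xs. gfun c x y) *
        (\<Prod>y\<in>set xs. F y (y + c) * (gfun c y x * (\<Prod>z\<in>set xs-{y}. gfun c y z)))"
    by (simp add: prod.distrib)
  also have "(\<Prod>y\<in>set xs. F y (y + c) * (gfun c y x * (\<Prod>z\<in>set xs-{y}. gfun c y z))) =
      (\<Prod>y\<in>set xs. F y (y + c) * (\<Prod>z\<in>set (x # xs)-{y}. gfun c y z))"
  proof (rule prod.cong)
    fix y assume "y \<in> set xs"
    hence "set (x # xs) - {y} = insert x (set xs - {y})" using Cons.prems by auto
    thus "F y (y + c) * (gfun c y x * (\<Prod>z\<in>set xs-{y}. gfun c y z)) =
        F y (y + c) * (\<Prod>z\<in>set (x # xs)-{y}. gfun c y z)"
      using Cons.prems by simp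
  qed simp
  finally show ?case using Cons.prems by simp
qed simp

text \<open>At \<open>y + c\<close> the part with \<open>lam 2\<close> vanishes by assumption, and
  the part with \<open>lam 1\<close> has a zero factor at \<open>i = y\<close> unless
  \<open>y\<close> is the point of the column. So the matrix is diagonal.\<close>

lemma slavnov_shifted:
  assumes "c \<noteq> 0" "distinct xs" and lam2: "\<And>x. x \<in> set xs \<Longrightarrow> lam 2 (x + c) = 0"
  shows "delta_list c xs *
      alternating_sum c (map (slavnov_column c lam (set xs)) xs) ((\<lambda>x. x + c) ` set xs) =
    (\<Prod>x\<in>set xs. - lam 1 (x + c))"
proof -
  have "slavnov_column c lam (set xs) x (y + c) = 0" if "x \<in> set xs" "y \<in> set xs" "x \<noteq> y" for x y
    using that lam2[of y] by (auto simp: slavnov_column_def)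
  moreover have "slavnov_column c lam (set xs) x (x + c) * (\<Prod>y\<in>set xs-{x}. gfun c x y) = - lam 1 (x + c)"
    if "x \<in> set xs" for x
  proof -
    have "(\<Prod>i\<in>set xs-{x}. (x + c - i - c) / c) * (\<Prod>y\<in>set xs-{x}. gfun c x y) = 1"
      unfolding prod.distrib[symmetric] using assms(1) by (intro prod.neutral) (auto simp: gfun_def)
    thus ?thesis using that assms(1) by (simp add: slavnov_column_def lam2 gfun_def[of c "x + c" x])
  qed
  ultimately show ?thesis using assms(2) by (simp add: alternating_sum_diagonal)
qed

text \<open>Both sides obey the same exchange relations, so their agreement at the shifted points
  suffices. The factors \<open>lam 2 x\<close> come from the quantum determinants there.\<close>

theorem (in generalized_model_nondeg) slavnov_formula:
  assumes xs: "distinct xs" "set xs = X" and U: "finite U" "card U = card X"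
    and X: "\<And>x y. x \<in> X \<Longrightarrow> y \<in> X \<Longrightarrow> x - y + c \<noteq> 0"
    and XU: "\<And>u x. u \<in> U \<Longrightarrow> x \<in> X \<Longrightarrow> u \<noteq> x \<and> u \<noteq> x + c"
    and on_shell: "\<And>x. x \<in> X \<Longrightarrow> bethe_defect c lam X x = 0"
  shows "dual_bethe X (bethe U) = (\<Prod>x\<in>X. lam 2 x) *
    (delta_list c xs * alternating_sum c (map (slavnov_column c lam X) xs) U)"
proof -
  define S where "S = (\<lambda>x. x + c) ` X"
  have finX: "finite X" using xs by auto
  have SX: "s \<notin> X" if "s \<in> S" for s
  proof
    assume "s \<in> X"
    with that obtain x where "x \<in> X" "s = x + c" by (auto simp: S_def)
    thus False using X[of x s] \<open>s \<in> X\<close> by simp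
  qed
  \<comment> \<open>The new model keeps the eigenvalues on \<open>X\<close> and \<open>U\<close> and
    takes the values 1 and 0 on \<open>S\<close>; genericity makes \<open>S\<close> disjoint from
    \<open>X\<close> and \<open>U\<close>.\<close>
  obtain T' lam' vac' dvac' where model: "generalized_model chain_scale c T' lam' vac' dvac'"
    and lam': "\<And>i w. w \<in> X \<union> U \<union> S \<Longrightarrow>
      lam' i w = (if w \<in> S then if i = 1 then 1 else 0 else lam i w)"
    using generalized_model_exists[of "X \<union> U \<union> S" c
        "\<lambda>i w. if w \<in> S then if i = 1 then 1 else 0 else lam i w"] finX U
    unfolding S_def by blast
  interpret N: generalized_model chain_scale c T' lam' vac' dvac' by (rule model)
  interpret two_models scl chain_scale c T T' lam lam' vac vac' dvac dvac'
    by standard (rule c_nonzero)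
  have agree: "lam' i w = lam i w" if "w \<in> X \<union> U" for i w
    using that lam'[of w i] SX XU by (auto simp: S_def)
  have lamS: "lam' 1 (x + c) = 1" "lam' 2 (x + c) = 0" if "x \<in> X" for x
    using that lam'[of "x + c"] by (auto simp: S_def)
  define A where "A = alternating_sum c (map (slavnov_column c lam' X) xs)"
  define E where "E = (\<lambda>V. N.dual_bethe X (N.bethe V) - (\<Prod>x\<in>X. lam' 2 x) * (delta_list c xs * A V))"
  have "E U = 0"
  proof (rule exchange_relation_unique[where U = U and X = X and lam = lam' and c = c])
    show "finite X" "finite U" "c \<noteq> 0" by (fact finX U c_nonzero)+
    show "E ((\<lambda>x. x + c) ` X) = 0"
    proof -
      have "N.dual_bethe X (N.bethe ((\<lambda>x. x + c) ` X)) = (\<Prod>x\<in>X. - (lam' 1 (x + c) * lam' 2 x))"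
        by (rule N.scalar_product_shifted[OF finX X lamS(2)])
      also have "\<dots> = (\<Prod>x\<in>X. lam' 2 x) * (\<Prod>x\<in>X. - lam' 1 (x + c))"
        unfolding prod.distrib[symmetric] by (simp add: mult.commute)
      also have "(\<Prod>x\<in>X. - lam' 1 (x + c)) = delta_list c xs * A ((\<lambda>x. x + c) ` X)"
        using slavnov_shifted[OF c_nonzero xs(1), of lam'] lamS xs(2) by (simp add: A_def)
      finally show ?thesis by (simp add: E_def)
    qed
    fix V x
    assume V: "V \<subseteq> U \<union> (\<lambda>x. x + c) ` X" "card V = card X" and x: "x \<in> X" "x + c \<notin> V"
    have finV: "finite V" using V U finX finite_subset by blast
    have zX: "x + c \<notin> X" using SX[of "x + c"] x by (auto simp: S_def)
    have VX: "V \<inter> X = {}"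
    proof (intro equals0I)
      fix v assume "v \<in> V \<inter> X"
      with V(1) SX[of v] XU[of v v] show False by (auto simp: S_def)
    qed
    have on_shell': "bethe_defect c lam' X y = 0" if "y \<in> X" for y
      using on_shell[OF that] agree that by (simp add: bethe_defect_def)
    have 1: "(transfer_value c lam' X (x + c) - transfer_value c lam' V (x + c)) * N.dual_bethe X (N.bethe V) =
      (\<Sum>v\<in>V. gfun c (x + c) v * bethe_defect c lam' V v * N.dual_bethe X (N.bethe (insert (x + c) (V - {v}))))"
      by (rule N.scalar_product_exchange[OF finX zX on_shell' finV x(2)])
    have 2: "(transfer_value c lam' X (x + c) - transfer_value c lam' V (x + c)) * A V =
      (\<Sum>v\<in>V. gfun c (x + c) v * bethe_defect c lam' V v * A (insert (x + c) (V - {v})))"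
      unfolding A_def using zX VX by (intro slavnov_exchange c_nonzero xs finV V x) auto
    define k where "k = (\<Prod>x\<in>X. lam' 2 x) * delta_list c xs"
    have E: "E V = N.dual_bethe X (N.bethe V) - k * A V" for V
      by (simp add: E_def k_def)
    have "t * (s - k * a) = t * s - k * (t * a)" for t s a :: complex by (simp add: algebra_simps)
    hence "(transfer_value c lam' X (x + c) - transfer_value c lam' V (x + c)) * E V =
       (transfer_value c lam' X (x + c) - transfer_value c lam' V (x + c)) * N.dual_bethe X (N.bethe V) -
       k * ((transfer_value c lam' X (x + c) - transfer_value c lam' V (x + c)) * A V)"
      unfolding E .
    also have "\<dots> = (\<Sum>v\<in>V. gfun c (x + c) v * bethe_defect c lam' V v * E (insert (x + c) (V - {v})))"
      unfolding 1 2 E sum_distrib_left sum_subtractf[symmetric]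
      by (intro sum.cong refl) (simp add: algebra_simps)
    finally show "(transfer_value c lam' X (x + c) - transfer_value c lam' V (x + c)) * E V =
      (\<Sum>v\<in>V. gfun c (x + c) v * bethe_defect c lam' V v * E (insert (x + c) (V - {v})))" .
  qed (use X XU lamS U in auto)
  moreover have "dual_bethe X (bethe U) = N.dual_bethe X (N.bethe U)"
    using XU by (intro scalar_product_eq finX U) (auto simp: agree)
  moreover have "A U = alternating_sum c (map (slavnov_column c lam X) xs) U"
    unfolding A_def by (intro alternating_sum_cong) (simp add: slavnov_column_def agree)
  moreover have "(\<Prod>x\<in>X. lam' 2 x) = (\<Prod>x\<in>X. lam 2 x)" by (simp add: agree)
  ultimately show ?thesis by (simp add: E_def)
qed

section \<open>The symmetrized sums\<close>

text \<open>Evaluates a symmetrization whose factor of index l depends only on the variable of index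
  l and on the set of the preceding variables: the last variable is chosen first.\<close>

primrec symmetrized ::
  "(nat \<Rightarrow> complex \<Rightarrow> complex set \<Rightarrow> complex) \<Rightarrow> nat \<Rightarrow> complex set \<Rightarrow> complex" where
  "symmetrized K 0 V = 1"
| "symmetrized K (Suc n) V = (\<Sum>v\<in>V. K (Suc n) v (V - {v}) * symmetrized K n (V - {v}))"

lemma Sym_eq_symmetrized:
  assumes "inj_on u {1..n}"
  shows "Sym n u (\<lambda>w. \<Prod>l=1..n. K l (w l) (w ` {1..<l})) = symmetrized K n (u ` {1..n})"
  using assms
proof (induction n arbitrary: u)
  case 0
  then show ?case by (simp add: Sym_def)
next
  case (Suc n)
  let ?N = "Suc n"
  have ins: "{1..?N} = insert ?N {1..n}" by auto
  have inner: "(\<Sum>q | q permutes {1..n}. \<Prod>l=1..?N. K l ((u \<circ> (Transposition.transpose ?N b \<circ> q)) l)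
        ((u \<circ> (Transposition.transpose ?N b \<circ> q)) ` {1..<l})) =
      K ?N (u b) (u ` {1..?N} - {u b}) * symmetrized K n (u ` {1..?N} - {u b})"
    if b: "b \<in> {1..?N}" for b
  proof -
    define u' where "u' = u \<circ> Transposition.transpose ?N b"
    have inj': "inj_on u' {1..?N}"
      unfolding u'_def using b Suc.prems by (intro comp_inj_on) (auto simp: inj_on_def Transposition.transpose_def)
    have tr: "Transposition.transpose ?N b ` {1..?N} = {1..?N}"
      using b permutes_image[OF permutes_swap_id[of ?N "{1..?N}" b]] by simp
    have u': "u' ?N = u b" by (simp add: u'_def)
    have im: "u' ` {1..n} = u ` {1..?N} - {u b}"
    proof -
      have "u' ` {1..?N} = u ` {1..?N}" unfolding u'_def image_comp[symmetric] tr ..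
      moreover have "u' ` {1..?N} = insert (u b) (u' ` {1..n})" unfolding ins by (simp add: u')
      moreover have "u' ?N \<notin> u' ` {1..n}" using inj_onD[OF inj', of ?N] by fastforce
      ultimately show ?thesis using u' by auto
    qed
    have "(\<Sum>q | q permutes {1..n}. \<Prod>l=1..?N. K l ((u \<circ> (Transposition.transpose ?N b \<circ> q)) l)
        ((u \<circ> (Transposition.transpose ?N b \<circ> q)) ` {1..<l})) =
      (\<Sum>q | q permutes {1..n}. K ?N (u b) (u' ` {1..n}) *
        (\<Prod>l=1..n. K l ((u' \<circ> q) l) ((u' \<circ> q) ` {1..<l})))"
    proof (rule sum.cong)
      fix q assume "q \<in> {q. q permutes {1..n}}"
      hence q: "q permutes {1..n}" by simp
      have "q ?N = ?N" using q by (auto simp: permutes_def)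
      hence last: "(u' \<circ> q) ?N = u b" by (simp add: u')
      have "(u' \<circ> q) ` {1..<?N} = u' ` {1..n}"
        unfolding atLeastLessThanSuc_atLeastAtMost image_comp[symmetric] permutes_image[OF q] ..
      moreover have "u \<circ> (Transposition.transpose ?N b \<circ> q) = u' \<circ> q" by (simp add: u'_def o_assoc)
      ultimately show "(\<Prod>l=1..?N. K l ((u \<circ> (Transposition.transpose ?N b \<circ> q)) l)
          ((u \<circ> (Transposition.transpose ?N b \<circ> q)) ` {1..<l})) =
        K ?N (u b) (u' ` {1..n}) * (\<Prod>l=1..n. K l ((u' \<circ> q) l) ((u' \<circ> q) ` {1..<l}))"
        using last by (simp del: o_apply add: prod.nat_ivl_Suc' mult.commute)
    qed simp
    also have "\<dots> = K ?N (u b) (u' ` {1..n}) * symmetrized K n (u' ` {1..n})"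
      using Suc.IH[of u'] inj' by (simp add: Sym_def sum_distrib_left[symmetric] inj_on_subset del: o_apply)
    finally show ?thesis unfolding im .
  qed
  \<comment> \<open>A permutation is given by the image \<open>b\<close> of the last index and a
    permutation of the other indices.\<close>
  have split: "(\<Sum>\<sigma> | \<sigma> permutes {1..?N}. G \<sigma>) =
      (\<Sum>b\<in>{1..?N}. \<Sum>q | q permutes {1..n}. G (Transposition.transpose ?N b \<circ> q))"
    for G :: "(nat \<Rightarrow> nat) \<Rightarrow> complex"
    unfolding ins by (rule sum_over_permutations_insert) auto
  have "Sym ?N u (\<lambda>w. \<Prod>l=1..?N. K l (w l) (w ` {1..<l})) =
      (\<Sum>b\<in>{1..?N}. K ?N (u b) (u ` {1..?N} - {u b}) * symmetrized K n (u ` {1..?N} - {u b}))"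
    unfolding Sym_def split by (rule sum.cong[OF refl inner])
  also have "\<dots> = (\<Sum>v\<in>u`{1..?N}. K ?N v (u ` {1..?N} - {v}) * symmetrized K n (u ` {1..?N} - {v}))"
    using Suc.prems by (subst sum.reindex) auto
  finally show ?case by simp
qed

text \<open>There are as many columns as points, so every term uses each point of \<open>V\<close>
  exactly once.\<close>

lemma alternating_sum_scale:
  assumes "finite V" "card V = length ks"
  shows "alternating_sum c (map (\<lambda>k v. F k v * a v) ks) V =
    (\<Prod>v\<in>V. a v) * alternating_sum c (map F ks) V"
  using assms
proof (induction ks arbitrary: V)
  case (Cons k ks)
  have "F k v * a v * (\<Prod>w\<in>V-{v}. gfun c w v) *
        alternating_sum c (map (\<lambda>k v. F k v * a v) ks) (V - {v}) =
      (\<Prod>v\<in>V. a v) * (F k v * (\<Prod>w\<in>V-{v}. gfun c w v) * alternating_sum c (map F ks) (V - {v}))"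
    if v: "v \<in> V" for v
  proof -
    have "alternating_sum c (map (\<lambda>k v. F k v * a v) ks) (V - {v}) =
        (\<Prod>v\<in>V-{v}. a v) * alternating_sum c (map F ks) (V - {v})"
      using Cons v by (intro Cons.IH) auto
    thus ?thesis using prod.remove[OF Cons.prems(1) v, of a] by simp
  qed
  then show ?case
    unfolding list.map alternating_sum.simps sum_distrib_left by (intro sum.cong refl)
qed simp

text \<open>The factors \<open>ffun\<close> coming from the parameters \<open>x k\<close> with \<open>k > l\<close> are absorbed into the vacuum eigenvalues.\<close>

definition dressed ::
  "complex \<Rightarrow> (2 \<Rightarrow> complex \<Rightarrow> complex) \<Rightarrow> nat \<Rightarrow> (nat \<Rightarrow> complex) \<Rightarrow> nat \<Rightarrow> 2 \<Rightarrow> complex \<Rightarrow> complex" where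
  "dressed c lam n x l i v =
    lam i v * (\<Prod>k\<in>{l<..n}. if i = 1 then ffun c (x k) v else ffun c v (x k))"

text \<open>The factor of index \<open>l\<close> in the summand: up to \<open>m\<close> it belongs
  to a determinant with dressed eigenvalues, beyond \<open>m\<close> it is a residue factor. The
  residue equals \<open>- c\<close> times the Bethe defect, and its \<open>c\<close> cancels one of
  the n - m prefactors 1/c.\<close>

definition mixed_kernel ::
  "complex \<Rightarrow> (2 \<Rightarrow> complex \<Rightarrow> complex) \<Rightarrow> nat \<Rightarrow> (nat \<Rightarrow> complex) \<Rightarrow> nat \<Rightarrow> nat
    \<Rightarrow> complex \<Rightarrow> complex set \<Rightarrow> complex" where
  "mixed_kernel c lam n x m l v V =
    (if l \<le> m then slavnov_column c (dressed c lam n x m) (x ` {1..m}) (x l) v *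
       (\<Prod>a\<in>V. gfun c a v) * (\<Prod>k\<in>{1..<l}. gfun c (x l) (x k))
     else - (gfun c v (x l) * bethe_defect c (dressed c lam n x l) (insert v V) v))"

text \<open>The order is decreasing, so that \<open>symmetrized\<close> and
  \<open>alternating_sum\<close> both treat \<open>x j\<close> first, and \<open>delta_list\<close>
  becomes the product of \<open>gfun c (x j) (x k)\<close> over k < j.\<close>

definition initial_list :: "(nat \<Rightarrow> complex) \<Rightarrow> nat \<Rightarrow> complex list" where
  "initial_list x j = map x (rev [1..<Suc j])"

lemma initial_list_simps [simp]:
  "initial_list x 0 = []" "initial_list x (Suc j) = x (Suc j) # initial_list x j"
  "set (initial_list x j) = x ` {1..j}" "length (initial_list x j) = j"
  by (auto simp: initial_list_def atLeastLessThanSuc_atLeastAtMost simp del: upt_Suc)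
    (simp_all add: initial_list_def)

lemma distinct_initial_list: "inj_on x {1..j} \<Longrightarrow> distinct (initial_list x j)"
  by (auto simp: initial_list_def distinct_map atLeastLessThanSuc_atLeastAtMost simp del: upt_Suc)

lemma symmetrized_mixed_kernel_initial:
  assumes "inj_on x {1..m}" "j \<le> m"
  shows "symmetrized (mixed_kernel c lam n x m) j V = delta_list c (initial_list x j) *
    alternating_sum c (map (slavnov_column c (dressed c lam n x m) (x ` {1..m})) (initial_list x j)) V"
  using assms(2)
proof (induction j arbitrary: V)
  case (Suc j)
  have "inj_on x {1..j}" using assms(1) by (rule inj_on_subset) (use Suc.prems in auto)
  hence "(\<Prod>k\<in>{1..<Suc j}. gfun c (x (Suc j)) (x k)) = (\<Prod>y\<in>x`{1..j}. gfun c (x (Suc j)) y)"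
    by (subst prod.reindex) (auto simp: atLeastLessThanSuc_atLeastAtMost)
  then show ?case
    using Suc by (simp add: mixed_kernel_def sum_distrib_left mult_ac)
qed simp

lemma dressed_step:
  assumes "1 \<le> m" "m \<le> n"
  shows "dressed c lam n x (m - 1) i v =
    dressed c lam n x m i v * (if i = 1 then ffun c (x m) v else ffun c v (x m))"
proof -
  have "{m - 1<..n} = insert m {m<..n}" using assms by auto
  thus ?thesis by (simp add: dressed_def)
qed

text \<open>Dressing with \<open>x m\<close> multiplies the eigenvalues by f, which is g times the
  very factor that the column loses when \<open>x m\<close> leaves the set. What remains is
  g.\<close>

lemma slavnov_column_step:
  assumes "c \<noteq> 0" "1 \<le> m" "m \<le> n" "inj_on x {1..m}" "1 \<le> k" "k < m" "v \<noteq> x m"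
  shows "slavnov_column c (dressed c lam n x (m - 1)) (x ` {1..m-1}) (x k) v =
    slavnov_column c (dressed c lam n x m) (x ` {1..m}) (x k) v * gfun c v (x m)"
proof -
  have "{1..m} = insert m {1..m-1}" using assms by auto
  hence im: "x ` {1..m} = insert (x m) (x ` {1..m-1})" by (metis image_insert)
  have xm: "x m \<notin> x ` {1..m-1}" "x m \<noteq> x k" using assms inj_onD[OF assms(4), of m] by fastforce+
  have X: "x ` {1..m} - {x k} = insert (x m) (x ` {1..m-1} - {x k})"
    unfolding im using xm by auto
  have P: "(\<Prod>i\<in>x`{1..m}-{x k}. F i) = F (x m) * (\<Prod>i\<in>x`{1..m-1}-{x k}. F i)" for F :: "complex \<Rightarrow> complex"
    unfolding X using xm by (subst prod.insert) auto
  note g = ffun_factor[OF assms(1,7)]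
  have d: "dressed c lam n x (m - 1) 1 v = dressed c lam n x m 1 v * (gfun c v (x m) * ((v - x m - c) / c))"
    "dressed c lam n x (m - 1) 2 v = dressed c lam n x m 2 v * (gfun c v (x m) * ((v - x m + c) / c))"
    unfolding g[symmetric] dressed_step[OF assms(2,3)] by simp_all
  show ?thesis unfolding slavnov_column_def P d by (simp add: algebra_simps)
qed

text \<open>A multiple of the column of \<open>x m\<close> may be replaced by the exchange column,
  because the columns of the other \<open>x k\<close> are already present and contribute 0. On
  \<open>V\<close> the exchange column consists of Bethe defects, which are the residue factors of
  the kernel for \<open>m - 1\<close>; the other columns change by
  \<open>slavnov_column_step\<close>.\<close>

lemma symmetrized_mixed_kernel_step:
  assumes "c \<noteq> 0" "1 \<le> m" "m \<le> n" "inj_on x {1..m}" "finite V" "card V = m" "V \<inter> x ` {1..m} = {}"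
  shows "symmetrized (mixed_kernel c lam n x m) m V = symmetrized (mixed_kernel c lam n x (m - 1)) m V"
proof -
  define X where "X = x ` {1..m}"
  define lam' where "lam' = dressed c lam n x m"
  define rest where "rest = initial_list x (m - 1)"
  let ?col = "slavnov_column c lam' X" and ?x = "x m"
  define D where "D = alternating_sum c (map ?col rest)"
  have m: "Suc (m - 1) = m" using assms by simp
  have list: "initial_list x m = ?x # rest"
    using initial_list_simps(2)[of x "m - 1"] by (simp only: rest_def m)
  have rest: "set rest = X - {?x}"
  proof -
    have "distinct (initial_list x m)" by (rule distinct_initial_list[OF assms(4)])
    moreover have "set (initial_list x m) = X" by (simp add: X_def)
    ultimately show ?thesis unfolding list by auto
  qed
  have X: "finite X" "?x \<in> X" "card V = card X" "V \<inter> X = {}"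
    using assms by (auto simp: X_def card_image)
  have Vx: "a \<noteq> ?x" if "a \<in> V" for a using that X by auto
  define p where "p = (\<Prod>a\<in>V. ?x - a)"
  have p: "p \<noteq> 0" using Vx assms(5) by (auto simp: p_def)
  have "p * (\<Prod>i\<in>X-{?x}. gfun c ?x i) * alternating_sum c (?col ?x # map ?col rest) V =
    (\<Sum>k\<in>X. ((\<Prod>a\<in>V. k - a) * (\<Prod>i\<in>X-{k}. gfun c k i)) * alternating_sum c (?col k # map ?col rest) V)"
    using X rest assms(5)
    by (simp add: sum.remove p_def alternating_sum_repeated sum.neutral del: alternating_sum.simps)
  also have "\<dots> = alternating_sum c (exchange_column c lam' X V # map ?col rest) V"
    unfolding alternating_sum_linear_hd[symmetric]
    using X assms(1,5) by (intro alternating_sum_cong_hd exchange_column_expansion) auto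
  also have "\<dots> = (\<Sum>v\<in>V. - ((- c) ^ m * bethe_defect c lam' V v) * D (V - {v}))"
    using assms(5,6) by (simp add: exchange_column_inside D_def)
  finally have 1: "p * (\<Prod>i\<in>X-{?x}. gfun c ?x i) * alternating_sum c (?col ?x # map ?col rest) V =
    (\<Sum>v\<in>V. - ((- c) ^ m * bethe_defect c lam' V v) * D (V - {v}))" .
  have "p * symmetrized (mixed_kernel c lam n x m) m V =
      delta_list c rest * (p * (\<Prod>i\<in>X-{?x}. gfun c ?x i) * alternating_sum c (?col ?x # map ?col rest) V)"
    using symmetrized_mixed_kernel_initial[OF assms(4) order_refl, of c lam n V]
    unfolding list lam'_def[symmetric] X_def[symmetric] by (simp add: rest mult_ac del: alternating_sum.simps)
  also have "\<dots> = p * symmetrized (mixed_kernel c lam n x (m - 1)) m V"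
  proof -
    have low: "symmetrized (mixed_kernel c lam n x (m - 1)) (m - 1) (V - {v}) =
        delta_list c rest * ((\<Prod>a\<in>V-{v}. gfun c a ?x) * D (V - {v}))" if v: "v \<in> V" for v
    proof -
      have inj: "inj_on x {1..m-1}" using assms(4) by (rule inj_on_subset) auto
      have "alternating_sum c (map (slavnov_column c (dressed c lam n x (m - 1)) (x ` {1..m-1})) rest) (V - {v}) =
          alternating_sum c (map (\<lambda>k v. ?col k v * gfun c v ?x) rest) (V - {v})"
      proof (rule alternating_sum_cong)
        fix k w assume "k \<in> set rest" "w \<in> V - {v}"
        then obtain j where "k = x j" "1 \<le> j" "j < m" "w \<noteq> ?x" using Vx assms(2) by (auto simp: rest_def)
        thus "slavnov_column c (dressed c lam n x (m - 1)) (x ` {1..m-1}) k w = ?col k w * gfun c w ?x"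
          using slavnov_column_step[OF assms(1-4)] by (simp add: lam'_def X_def)
      qed
      also have "\<dots> = (\<Prod>a\<in>V-{v}. gfun c a ?x) * D (V - {v})"
        unfolding D_def using v assms by (intro alternating_sum_scale) (auto simp: rest_def)
      finally show ?thesis
        using symmetrized_mixed_kernel_initial[OF inj order_refl, of c lam n "V - {v}"]
        by (simp add: rest_def)
    qed
    have "symmetrized (mixed_kernel c lam n x (m - 1)) m V =
      (\<Sum>v\<in>V. mixed_kernel c lam n x (m - 1) m v (V - {v}) *
        symmetrized (mixed_kernel c lam n x (m - 1)) (m - 1) (V - {v}))"
      using symmetrized.simps(2)[of "mixed_kernel c lam n x (m - 1)" "m - 1" V] by (simp only: m)
    also have "\<dots> = (\<Sum>v\<in>V. delta_list c rest * (- (bethe_defect c lam' V v *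
        (\<Prod>a\<in>V. gfun c a ?x) * D (V - {v}))))"
    proof (rule sum.cong)
      fix v assume v: "v \<in> V"
      have "mixed_kernel c lam n x (m - 1) m v (V - {v}) = - (gfun c v ?x * bethe_defect c lam' V v)"
        using assms(2) v by (auto simp: mixed_kernel_def lam'_def insert_absorb)
      moreover have "(\<Prod>a\<in>V. gfun c a ?x) = gfun c v ?x * (\<Prod>a\<in>V-{v}. gfun c a ?x)"
        by (rule prod.remove[OF assms(5) v])
      ultimately show "mixed_kernel c lam n x (m - 1) m v (V - {v}) *
          symmetrized (mixed_kernel c lam n x (m - 1)) (m - 1) (V - {v}) =
        delta_list c rest * (- (bethe_defect c lam' V v * (\<Prod>a\<in>V. gfun c a ?x) * D (V - {v})))"
        unfolding low[OF v] by (simp add: mult_ac)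
    qed simp
    also have "p * \<dots> = delta_list c rest * (\<Sum>v\<in>V. - (p * (\<Prod>a\<in>V. gfun c a ?x) * bethe_defect c lam' V v) * D (V - {v}))"
      by (simp add: sum_distrib_left mult_ac)
    also have "p * (\<Prod>a\<in>V. gfun c a ?x) = (- c) ^ m"
      unfolding p_def using prod_gfun_mult(1)[OF Vx] assms(6) by simp
    finally show ?thesis unfolding 1 by simp
  qed
  finally show ?thesis using p by simp
qed

lemma symmetrized_mixed_kernel_independent:
  assumes "c \<noteq> 0" "m \<le> n" "inj_on x {1..n}" "finite V" "card V = n" "V \<inter> x ` {1..n} = {}"
  shows "symmetrized (mixed_kernel c lam n x m) n V = symmetrized (mixed_kernel c lam n x n) n V"
proof -
  have down: "symmetrized (mixed_kernel c lam n x k) n V = symmetrized (mixed_kernel c lam n x (k - 1)) n V"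
    if "1 \<le> k" "k \<le> n" for k
  proof -
    \<comment> \<open>At indices above \<open>k\<close> the two kernels agree, so the outer sums
      preserve the equality that holds at level \<open>k\<close>.\<close>
    have "symmetrized (mixed_kernel c lam n x k) j W = symmetrized (mixed_kernel c lam n x (k - 1)) j W"
      if "k \<le> j" "finite W" "card W = j" "W \<inter> x ` {1..n} = {}" for j W
      using that
    proof (induction j arbitrary: W rule: dec_induct)
      case base
      have "inj_on x {1..k}" using assms(3) by (rule inj_on_subset) (use \<open>k \<le> n\<close> in auto)
      thus ?case using base \<open>1 \<le> k\<close> \<open>k \<le> n\<close>
        by (intro symmetrized_mixed_kernel_step assms(1)) auto
    next
      case (step j)
      have "mixed_kernel c lam n x k (Suc j) v (W - {v}) = mixed_kernel c lam n x (k - 1) (Suc j) v (W - {v})" for v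
      proof -
        have "\<not> Suc j \<le> k" "\<not> Suc j \<le> k - 1" using step.hyps by linarith+
        thus ?thesis by (simp add: mixed_kernel_def)
      qed
      moreover have "symmetrized (mixed_kernel c lam n x k) j (W - {v}) =
          symmetrized (mixed_kernel c lam n x (k - 1)) j (W - {v})" if "v \<in> W" for v
        using that step.prems by (intro step.IH) auto
      ultimately show ?case by simp
    qed
    from this[OF \<open>k \<le> n\<close> assms(4-6)] show ?thesis .
  qed
  show ?thesis
    using assms(2)
  proof (induction m rule: inc_induct)
    case (step k)
    then show ?case using down[of "Suc k"] by simp
  qed simp
qed

section \<open>From the stated summand to the kernels\<close>

lemma J_fun_eq_slavnov_column:
  assumes "c \<noteq> 0" "inj_on x {1..n}" "k \<in> {1..n}" "\<And>i. i \<in> {1..n} \<Longrightarrow> v \<noteq> x i"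
  shows "J_fun c lam n x k v = slavnov_column c lam (x ` {1..n}) (x k) v"
proof -
  let ?A = "{1..n} - {k}"
  have split: "(\<Prod>i=1..n. F i) = F k * (\<Prod>i\<in>?A. F i)" for F :: "nat \<Rightarrow> complex"
    using assms(3) by (simp add: prod.remove)
  have vk: "v - x k \<noteq> 0" "x k - v \<noteq> 0" "v \<noteq> x k" "x k \<noteq> v" using assms(3,4) by auto
  define P where "P = (\<Prod>i\<in>?A. ffun c (x i) v)"
  define Q where "Q = (\<Prod>i\<in>?A. ffun c v (x i))"
  define G where "G = (\<Prod>i\<in>?A. gfun c v (x i))"
  have tau: "tau c lam {1..n} (x(k := y)) v = lam 1 v * (ffun c y v * P) + lam 2 v * (ffun c v y * Q)" for y
    unfolding tau_def split P_def Q_def by simp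
  have "((\<lambda>y. ffun c y v) has_field_derivative (- c / (x k - v)^2)) (at (x k))"
    "((\<lambda>y. ffun c v y) has_field_derivative (c / (v - x k)^2)) (at (x k))"
    unfolding ffun_def using vk
    by (auto intro!: derivative_eq_intros simp: divide_simps power2_eq_square algebra_simps)
  hence "((\<lambda>y. tau c lam {1..n} (x(k := y)) v) has_field_derivative
      lam 1 v * ((- c / (x k - v)^2) * P) + lam 2 v * ((c / (v - x k)^2) * Q)) (at (x k))"
    unfolding tau by (intro DERIV_add DERIV_cmult DERIV_cmult_right)
  hence D: "deriv (\<lambda>y. tau c lam {1..n} (x(k := y)) v) (x k) =
      c / (v - x k)^2 * (lam 2 v * Q - lam 1 v * P)"
    by (subst DERIV_imp_deriv) (auto simp: power2_commute[of "x k" v] algebra_simps)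
  have G: "G \<noteq> 0" using assms by (auto simp: G_def gfun_def)
  have ff: "ffun c v (x i) = gfun c v (x i) * ((v - x i + c) / c)"
    "ffun c (x i) v = gfun c v (x i) * ((v - x i - c) / c)" if "i \<in> ?A" for i
  proof -
    have "v \<noteq> x i" using assms(4) that by simp
    from ffun_factor[OF assms(1) this]
    show "ffun c v (x i) = gfun c v (x i) * ((v - x i + c) / c)"
      "ffun c (x i) v = gfun c v (x i) * ((v - x i - c) / c)" .
  qed
  have PQ: "Q = G * (\<Prod>i\<in>?A. (v - x i + c) / c)" "P = G * (\<Prod>i\<in>?A. (v - x i - c) / c)"
    unfolding P_def Q_def G_def prod.distrib[symmetric]
    by (simp_all only: ff cong: prod.cong)
  have im: "x ` {1..n} - {x k} = x ` ?A"
    using inj_on_image_set_diff[OF assms(2), of "{1..n}" "{k}"] assms(3) by simp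
  have inj: "inj_on x ?A" using assms(2) by (rule inj_on_subset) auto
  have "J_fun c lam n x k v = c / (gfun c v (x k) * G) * (c / (v - x k)^2 * (lam 2 v * Q - lam 1 v * P))"
    unfolding J_fun_def D split[of "\<lambda>i. gfun c v (x i)"] G_def ..
  \<comment> \<open>The common factor \<open>G\<close> of \<open>P\<close> and \<open>Q\<close>
    cancels against the prefactor of J.\<close>
  also have "\<dots> = gfun c v (x k) * (lam 2 v * (\<Prod>i\<in>?A. (v - x i + c) / c) - lam 1 v * (\<Prod>i\<in>?A. (v - x i - c) / c))"
  proof -
    have "c / (c / d * G) * (c / d^2 * (a * (G * p) - b * (G * q))) = c / d * (a * p - b * q)"
      if "d \<noteq> 0" for a b d p q :: complex
      using G that assms(1) by (simp add: divide_simps power2_eq_square) (simp add: algebra_simps)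
    from this[OF vk(1)] show ?thesis unfolding PQ gfun_def .
  qed
  also have "\<dots> = slavnov_column c lam (x ` {1..n}) (x k) v"
    unfolding slavnov_column_def im prod.reindex[OF inj] by simp
  finally show ?thesis .
qed

text \<open>Descending induction from m = n, where nothing is dressed; each step absorbs one factor
  g by \<open>slavnov_column_step\<close>.\<close>

lemma slavnov_column_dressed:
  assumes "c \<noteq> 0" "m \<le> n" "inj_on x {1..n}" "k \<in> {1..m}" "\<And>i. i \<in> {1..n} \<Longrightarrow> v \<noteq> x i"
  shows "J_fun c lam n x k v * (\<Prod>l=m+1..n. gfun c v (x l)) =
    slavnov_column c (dressed c lam n x m) (x ` {1..m}) (x k) v"
  using assms(2,4)
proof (induction m rule: inc_induct)
  case base
  then show ?case using J_fun_eq_slavnov_column[OF assms(1,3) _ assms(5), of k]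
    by (simp add: dressed_def[abs_def])
next
  case (step m)
  have "{m+1..n} = insert (Suc m) {Suc m+1..n}" using step.hyps by auto
  hence "J_fun c lam n x k v * (\<Prod>l=m+1..n. gfun c v (x l)) =
      J_fun c lam n x k v * (\<Prod>l=Suc m+1..n. gfun c v (x l)) * gfun c v (x (Suc m))"
    by (simp add: mult_ac)
  also have "\<dots> = slavnov_column c (dressed c lam n x (Suc m)) (x ` {1..Suc m}) (x k) v * gfun c v (x (Suc m))"
    using step by simp
  also have "\<dots> = slavnov_column c (dressed c lam n x m) (x ` {1..m}) (x k) v"
  proof -
    have "inj_on x {1..Suc m}" using assms(3) by (rule inj_on_subset) (use step.hyps in auto)
    thus ?thesis
      using slavnov_column_step[OF assms(1), of "Suc m" n x k v lam] step assms(5) by simp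
  qed
  finally show ?case .
qed

text \<open>Groups the pairs by their larger index, which distributes \<open>Delta_prime\<close>
  over the kernels.\<close>

lemma prod_pairs_swap:
  fixes P :: "nat \<Rightarrow> nat \<Rightarrow> complex"
  shows "(\<Prod>j=1..m. \<Prod>k\<in>{j<..m}. P j k) = (\<Prod>k=1..m. \<Prod>j\<in>{1..<k}. P j k)"
proof -
  have "(\<Prod>j=1..m. \<Prod>k\<in>{k\<in>{1..m}. j < k}. P j k) = (\<Prod>k=1..m. \<Prod>j\<in>{j\<in>{1..m}. j < k}. P j k)"
    by (rule prod.swap_restrict) auto
  moreover have "{k\<in>{1..m}. j < k} = {j<..m}" if "j \<in> {1..m}" for j using that by auto
  moreover have "{j\<in>{1..m}. j < k} = {1..<k}" if "k \<in> {1..m}" for k using that by auto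
  ultimately show ?thesis by simp
qed

text \<open>The parameters \<open>x i\<close> with i > l enter the residue only through the factors
  f that dress the vacuum eigenvalues.\<close>

lemma tau_res_eq_bethe_defect:
  assumes "inj_on w {1..n}" "l \<in> {1..n}"
  shows "tau_res c lam {1..n} (\<lambda>i. if i \<le> l then w i else x i) l =
    - (c * bethe_defect c (dressed c lam n x l) (insert (w l) (w ` {1..<l})) (w l))"
proof -
  have sets: "{1..n} - {l} = {1..<l} \<union> {l<..n}" using assms(2) by auto
  have split: "(\<Prod>i\<in>{1..n}-{l}. F (if i \<le> l then w i else x i)) =
      (\<Prod>i\<in>{1..<l}. F (w i)) * (\<Prod>i\<in>{l<..n}. F (x i))" for F :: "complex \<Rightarrow> complex"
    unfolding sets
    by (subst prod.union_disjoint) (auto intro!: arg_cong2[where f = "(*)"] prod.cong)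
  have inj: "inj_on w {1..<l}" using assms by (auto intro: inj_on_subset)
  have "w l \<notin> w ` {1..<l}" using inj_onD[OF assms(1), of l] assms(2) by fastforce
  hence "insert (w l) (w ` {1..<l}) - {w l} = w ` {1..<l}" by auto
  thus ?thesis
    by (simp only: tau_res_def bethe_defect_def order_refl if_True prod.reindex[OF inj]
        split[of "ffun c (w l)"] split[of "\<lambda>y. ffun c y (w l)"])
      (simp add: dressed_def algebra_simps)
qed

lemma summand_eq_mixed_kernel:
  assumes "c \<noteq> 0" "m \<le> n" "inj_on x {1..n}" "inj_on w {1..n}"
    and "\<And>i j. i \<in> {1..n} \<Longrightarrow> j \<in> {1..n} \<Longrightarrow> w i \<noteq> x j"
  shows "1 / c ^ (n - m) *
     ((\<Prod>i=1..m. J_fun c lam n x i (w i) * (\<Prod>l=m+1..n. gfun c (w i) (x l))) *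
       Delta_prime c m w * Delta c m x *
       (\<Prod>l=m+1..n. gfun c (w l) (x l) * tau_res c lam {1..n} (\<lambda>i. if i \<le> l then w i else x i) l)) =
    (\<Prod>l=1..n. mixed_kernel c lam n x m l (w l) (w ` {1..<l}))"
proof -
  have low: "(\<Prod>i=1..m. J_fun c lam n x i (w i) * (\<Prod>l=m+1..n. gfun c (w i) (x l))) *
      Delta_prime c m w * Delta c m x =
    (\<Prod>l=1..m. mixed_kernel c lam n x m l (w l) (w ` {1..<l}))"
    unfolding Delta_prime_def Delta_def prod_pairs_swap prod.distrib[symmetric]
  proof (rule prod.cong)
    fix l assume l: "l \<in> {1..m}"
    have inj: "inj_on w {1..<l}" using assms(4) by (rule inj_on_subset) (use l assms(2) in auto)
    have "J_fun c lam n x l (w l) * (\<Prod>k=m+1..n. gfun c (w l) (x k)) =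
        slavnov_column c (dressed c lam n x m) (x ` {1..m}) (x l) (w l)"
      using l assms(2,5) by (intro slavnov_column_dressed assms(1-3)) auto
    thus "J_fun c lam n x l (w l) * (\<Prod>k=m+1..n. gfun c (w l) (x k)) * (\<Prod>j\<in>{1..<l}. gfun c (w j) (w l)) *
        (\<Prod>j\<in>{1..<l}. gfun c (x l) (x j)) = mixed_kernel c lam n x m l (w l) (w ` {1..<l})"
      using l unfolding mixed_kernel_def prod.reindex[OF inj] by simp
  qed simp
  have high: "1 / c ^ (n - m) *
      (\<Prod>l=m+1..n. gfun c (w l) (x l) * tau_res c lam {1..n} (\<lambda>i. if i \<le> l then w i else x i) l) =
    (\<Prod>l=m+1..n. mixed_kernel c lam n x m l (w l) (w ` {1..<l}))"
  proof -
    have const: "1 / c ^ (n - m) = (\<Prod>l=m+1..n. 1 / c)"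
      by (simp add: power_divide)
    show ?thesis
      unfolding const prod.distrib[symmetric]
    proof (rule prod.cong)
      fix l assume l: "l \<in> {m+1..n}"
      hence "l \<in> {1..n}" "\<not> l \<le> m" by auto
      thus "1 / c * (gfun c (w l) (x l) * tau_res c lam {1..n} (\<lambda>i. if i \<le> l then w i else x i) l) =
          mixed_kernel c lam n x m l (w l) (w ` {1..<l})"
        unfolding tau_res_eq_bethe_defect[OF assms(4) \<open>l \<in> {1..n}\<close>] mixed_kernel_def
        using assms(1) by simp
    qed simp
  qed
  have split: "(\<Prod>l=1..n. F l) = (\<Prod>l=1..m. F l) * (\<Prod>l=m+1..n. F l)" for F :: "nat \<Rightarrow> complex"
    using assms(2) by (subst prod.union_disjoint[symmetric]) (auto intro: prod.cong)
  show ?thesis unfolding split low[symmetric] high[symmetric] by simp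
qed

lemma bethe_equations_defect:
  assumes "bethe_equations c lam n x" "inj_on x {1..n}"
    and "\<And>i j. i \<in> {1..n} \<Longrightarrow> j \<in> {1..n} \<Longrightarrow> x i - x j + c \<noteq> 0"
    and "i \<in> {1..n}"
  shows "bethe_defect c lam (x ` {1..n}) (x i) = 0"
proof -
  let ?A = "{1..n} - {i}"
  have im: "x ` {1..n} - {x i} = x ` ?A"
    using inj_on_image_set_diff[OF assms(2), of "{1..n}" "{i}"] assms(4) by simp
  have inj: "inj_on x ?A" using assms(2) by (rule inj_on_subset) auto
  have "ffun c (x j) (x i) \<noteq> 0" if "j \<in> ?A" for j
    using that assms(3)[of j i] assms(4) inj_onD[OF assms(2), of j i] by (auto simp: ffun_def)
  hence "(\<Prod>j\<in>?A. ffun c (x j) (x i)) \<noteq> 0" by simp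
  moreover have "lam 2 (x i) \<noteq> 0"
    "lam 1 (x i) / lam 2 (x i) = (\<Prod>j\<in>?A. ffun c (x i) (x j)) / (\<Prod>j\<in>?A. ffun c (x j) (x i))"
    using assms(1,4) by (simp_all add: bethe_equations_def prod_dividef)
  ultimately have "lam 1 (x i) * (\<Prod>j\<in>?A. ffun c (x j) (x i)) = lam 2 (x i) * (\<Prod>j\<in>?A. ffun c (x i) (x j))"
    by (simp add: divide_simps mult.commute)
  thus ?thesis unfolding bethe_defect_def im prod.reindex[OF inj] by simp
qed

theorem theorem3p2:
  fixes c :: complex
    and scl :: "complex \<Rightarrow> 'h::ab_group_add \<Rightarrow> 'h"
    and T :: "2 \<Rightarrow> 2 \<Rightarrow> complex \<Rightarrow> 'h \<Rightarrow> 'h"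
    and lam :: "2 \<Rightarrow> complex \<Rightarrow> complex"
    and vac :: 'h
    and dvac :: "'h \<Rightarrow> complex"
    and n m :: nat
    and x u :: "nat \<Rightarrow> complex"
  assumes "c \<noteq> 0"
    and "generalized_model scl c T lam vac dvac"
    and "1 \<le> m" and "m \<le> n"
    and "inj_on x {1..n}" and "inj_on u {1..n}"
    and "\<forall>i\<in>{1..n}. \<forall>j\<in>{1..n}. u i \<noteq> x j"
    and "\<forall>i\<in>{1..n}. \<forall>j\<in>{1..n}. x i - x j + c \<noteq> 0"
    and "\<forall>i\<in>{1..n}. \<forall>j\<in>{1..n}. u i - x j + c \<noteq> 0 \<and> x j - u i + c \<noteq> 0"
    and "bethe_equations c lam n x"
  shows "dual_bethe_vector T dvac n x (bethe_vector T vac n u) =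
    (\<Prod>i=1..n. lam 2 (x i)) *
    (1 / c ^ (n - m) *
     Sym n u (\<lambda>w.
       (\<Prod>i=1..m. J_fun c lam n x i (w i) * (\<Prod>l=m+1..n. gfun c (w i) (x l))) *
       Delta_prime c m w * Delta c m x *
       (\<Prod>l=m+1..n. gfun c (w l) (x l) *
          tau_res c lam {1..n} (\<lambda>i. if i \<le> l then w i else x i) l)))"
proof -
  interpret generalized_model scl c T lam vac dvac by fact
  interpret generalized_model_nondeg scl c T lam vac dvac by standard fact
  let ?X = "x ` {1..n}" and ?U = "u ` {1..n}"
  let ?summand = "\<lambda>w. (\<Prod>i=1..m. J_fun c lam n x i (w i) * (\<Prod>l=m+1..n. gfun c (w i) (x l))) *
       Delta_prime c m w * Delta c m x *
       (\<Prod>l=m+1..n. gfun c (w l) (x l) *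
          tau_res c lam {1..n} (\<lambda>i. if i \<le> l then w i else x i) l)"
  have card: "card ?U = n" "card ?X = n"
    using card_image[OF assms(6)] card_image[OF assms(5)] by simp_all
  have UX: "?U \<inter> ?X = {}" using assms(7) by auto
  have "1 / c ^ (n - m) * Sym n u ?summand =
      Sym n u (\<lambda>w. \<Prod>l=1..n. mixed_kernel c lam n x m l (w l) (w ` {1..<l}))"
    unfolding Sym_def sum_distrib_left
  proof (rule sum.cong)
    fix \<sigma> assume "\<sigma> \<in> {\<sigma>. \<sigma> permutes {1..n}}"
    hence \<sigma>: "\<sigma> permutes {1..n}" by simp
    have "inj_on (u \<circ> \<sigma>) {1..n}"
      using assms(6) permutes_image[OF \<sigma>] permutes_inj_on[OF \<sigma>] by (intro comp_inj_on) auto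
    moreover have "(u \<circ> \<sigma>) i \<noteq> x j" if "i \<in> {1..n}" "j \<in> {1..n}" for i j
      using assms(7) permutes_in_image[OF \<sigma>, of i] that by auto
    ultimately show "1 / c ^ (n - m) * ?summand (u \<circ> \<sigma>) =
        (\<Prod>l=1..n. mixed_kernel c lam n x m l ((u \<circ> \<sigma>) l) ((u \<circ> \<sigma>) ` {1..<l}))"
      by (rule summand_eq_mixed_kernel[OF assms(1,4,5)])
  qed simp
  also have "\<dots> = symmetrized (mixed_kernel c lam n x m) n ?U"
    by (rule Sym_eq_symmetrized[OF assms(6)])
  \<comment> \<open>For m = n there are neither residue factors nor dressing, and the sum is the
    determinant of \<open>slavnov_formula\<close>.\<close>
  also have "\<dots> = symmetrized (mixed_kernel c lam n x n) n ?U"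
    by (rule symmetrized_mixed_kernel_independent[OF assms(1,4,5) _ card(1) UX]) simp
  also have "\<dots> = delta_list c (initial_list x n) *
      alternating_sum c (map (slavnov_column c lam ?X) (initial_list x n)) ?U"
    using symmetrized_mixed_kernel_initial[OF assms(5) order_refl, of c lam n ?U]
    by (simp add: dressed_def[abs_def])
  also have "(\<Prod>i=1..n. lam 2 (x i)) * \<dots> = dual_bethe ?X (bethe ?U)"
  proof -
    have "dual_bethe ?X (bethe ?U) = (\<Prod>x\<in>?X. lam 2 x) * (delta_list c (initial_list x n) *
        alternating_sum c (map (slavnov_column c lam ?X) (initial_list x n)) ?U)"
    proof (rule slavnov_formula)
      show "card ?U = card ?X" by (simp only: card)
      show "v \<noteq> y \<and> v \<noteq> y + c" if "v \<in> ?U" "y \<in> ?X" for v y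
      proof -
        from that obtain i j where ij: "i \<in> {1..n}" "j \<in> {1..n}" "v = u i" "y = x j" by auto
        hence "u i \<noteq> x j" "x j - u i + c \<noteq> 0" using assms(7,9) by blast+
        thus ?thesis unfolding ij by auto
      qed
      show "bethe_defect c lam ?X y = 0" if "y \<in> ?X" for y
        using that bethe_equations_defect[OF assms(10,5)] assms(8) by auto
    qed (use assms(5,8) in \<open>auto simp: distinct_initial_list\<close>)
    thus ?thesis unfolding prod.reindex[OF assms(5)] by simp
  qed
  also have "\<dots> = dual_bethe_vector T dvac n x (bethe_vector T vac n u)"
    by (simp add: dual_bethe_vector_eq[OF assms(5)] bethe_vector_eq[OF assms(6)])
  finally show ?thesis by (rule sym)
qed

end
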